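(* Let $n\ge 1$ and let $\mathcal{H}\subset\mathbb{R}^{n+1}$ be a Euclidean complete connected hyperbolic centroaffine hypersurface with regular boundary behaviour. Then $\mathcal{H}$ is complete with respect to the centroaffine metric.
   Context: Let $\tilde\nabla$ be the canonical flat connection on $\mathbb{R}^{n+1}$ and $\xi$ the position vector field. A smooth embedded hypersurface $\mathcal{H}\subset\mathbb{R}^{n+1}$ is centroaffine if $x\notin T_x\mathcal{H}$ for all $x\in\mathcal{H}$. Its centroaffine metric $g$ is the symmetric tensor field determined by $\tilde\nabla_XY=\nabla_XY+g(X,Y)\xi$ for $X,Y$ tangent to $\mathcal{H}$, with $\nabla_XY$ tangent to $\mathcal{H}$. $\mathcal{H}$ is hyperbolic if $g$ is positive definite. It is Euclidean complete if it is complete for the Riemannian metric induced by the Euclidean scalar product of $\mathbb{R}^{n+1}$. A smooth function $h$ on an open set is homogeneous of degree $k$ if $\sum_ix^i\partial_ih=kh$. Regular boundary behaviour: put $U=\mathbb{R}^{>0}\cdot\mathcal{H}$ and let $h:U\to\mathbb{R}$ be a smooth homogeneous function of degree $k>1$ with $\mathcal{H}=\{p\in U\mid h(p)=1\}$. It is assumed that $h$ extends to a smooth homogeneous function $h:V\to\mathbb{R}$ on some open set $V\subset\mathbb{R}^{n+1}$ with $\overline{U}\setminus\{0\}\subset V$. Under this assumption, $\mathcal{H}$ has regular boundary behaviour if (i) $dh_p\ne0$ for all $p\in\partial U\setminus\{0\}$ (in particular $\partial U\setminus\{0\}$ is a smooth hypersurface), and (ii) the restriction of $-\tilde\nabla^2h$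 to $T(\partial U\setminus\{0\})$ is positive semi-definite with only one-dimensional kernel (at each point). *)

theory Defs
  imports "HOL-Analysis.Analysis"
begin

section \<open>Smooth maps and smooth hypersurfaces\<close>

fun Ck_on :: "nat \<Rightarrow> ('a::euclidean_space \<Rightarrow> 'b::real_normed_vector) \<Rightarrow> 'a set \<Rightarrow> bool" where
  "Ck_on 0 f S \<longleftrightarrow> continuous_on S f"
| "Ck_on (Suc k) f S \<longleftrightarrow>
     f differentiable_on S \<and> (\<forall>v. Ck_on k (\<lambda>x. frechet_derivative f (at x) v) S)"

definition smooth_on :: "('a::euclidean_space \<Rightarrow> 'b::real_normed_vector) \<Rightarrow> 'a set \<Rightarrow> bool" where
  "smooth_on f S \<longleftrightarrow> open S \<and> (\<forall>k. Ck_on k f S)"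

text \<open>Embedded hypersurfaces (without boundary) are defined by slice charts.\<close>

definition smooth_hypersurface :: "'a::euclidean_space set \<Rightarrow> bool" where
  "smooth_hypersurface H \<longleftrightarrow>
     (\<forall>p\<in>H. \<exists>W Q (\<phi>::'a \<Rightarrow> 'a) \<psi>. \<exists>b\<in>Basis.
        p \<in> W \<and> smooth_on \<phi> W \<and> smooth_on \<psi> Q \<and> homeomorphism W Q \<phi> \<psi> \<and>
        \<phi> ` (H \<inter> W) = {y \<in> Q. y \<bullet> b = 0})"

definition tangent_space :: "'a::euclidean_space set \<Rightarrow> 'a \<Rightarrow> 'a set" where
  "tangent_space H p =
     {v. \<exists>\<gamma> e. e > 0 \<and> smooth_on \<gamma> {-e<..<e::real} \<and> \<gamma> ` {-e<..<e} \<subseteq> H \<and>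
           \<gamma> 0 = p \<and> (\<gamma> has_vector_derivative v) (at 0)}"


section \<open>Riemannian completeness\<close>

text \<open>
  A field of bilinear forms on \<open>H\<close> is a function \<open>g\<close>, with \<open>g p v w\<close> relevant only for
  \<open>p \<in> H\<close> and \<open>v\<close>, \<open>w\<close> tangent to \<open>H\<close> at \<open>p\<close>. Lengths and distances take values in
  \<^typ>\<open>ennreal\<close>: the derivative of a \<^const>\<open>valid_path\<close> may be unbounded near one of the
  finitely many exceptional parameters, and then the length may be infinite. Points that
  cannot be joined in \<open>H\<close> have distance infinity.
\<close>

definition curve_length ::
  "('a::euclidean_space \<Rightarrow> 'a \<Rightarrow> 'a \<Rightarrow> real) \<Rightarrow> (real \<Rightarrow> 'a) \<Rightarrow> ennreal" where
  "curve_length g \<gamma> =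
     (\<integral>\<^sup>+t\<in>{0..1}. ennreal (sqrt (g (\<gamma> t) (vector_derivative \<gamma> (at t)) (vector_derivative \<gamma> (at t))))
        \<partial>lborel)"

definition riemannian_dist ::
  "'a::euclidean_space set \<Rightarrow> ('a \<Rightarrow> 'a \<Rightarrow> 'a \<Rightarrow> real) \<Rightarrow> 'a \<Rightarrow> 'a \<Rightarrow> ennreal" where
  "riemannian_dist H g x y =
     Inf {curve_length g \<gamma> | \<gamma>.
            valid_path \<gamma> \<and> path_image \<gamma> \<subseteq> H \<and> pathstart \<gamma> = x \<and> pathfinish \<gamma> = y}"

definition riemannian_complete ::
  "'a::euclidean_space set \<Rightarrow> ('a \<Rightarrow> 'a \<Rightarrow> 'a \<Rightarrow> real) \<Rightarrow> bool" where
  "riemannian_complete H g \<longleftrightarrow>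
     (\<forall>\<sigma>::nat \<Rightarrow> 'a.
        range \<sigma> \<subseteq> H \<and>
        (\<forall>e>0. \<exists>N. \<forall>i\<ge>N. \<forall>j\<ge>N. riemannian_dist H g (\<sigma> i) (\<sigma> j) < e) \<longrightarrow>
        (\<exists>l\<in>H. (\<lambda>i. riemannian_dist H g (\<sigma> i) l) \<longlonglongrightarrow> 0))"

definition euclidean_complete :: "'a::euclidean_space set \<Rightarrow> bool" where
  "euclidean_complete H \<longleftrightarrow> riemannian_complete H (\<lambda>p v w. v \<bullet> w)"


section \<open>Centroaffine hypersurfaces\<close>

definition centroaffine_hypersurface :: "'a::euclidean_space set \<Rightarrow> bool" where
  "centroaffine_hypersurface H \<longleftrightarrow>
     smooth_hypersurface H \<and> (\<forall>p\<in>H. p \<notin> tangent_space H p)"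

text \<open>
  The Gauss formula at \<open>p\<close>: the flat derivative in direction \<open>v\<close> of a vector field \<open>Y\<close>
  tangent to \<open>H\<close> with \<open>Y p = w\<close> equals a tangent vector plus \<open>g p v w\<close> times the position
  vector \<open>p\<close>. Tangent vector fields are given by smooth extensions to a neighbourhood of
  \<open>p\<close> in the ambient space; for tangent \<open>v\<close> the derivative at \<open>p\<close> does not depend on the
  extension. The value is meaningful only for \<open>p \<in> H\<close> and \<open>v\<close>, \<open>w\<close> tangent to \<open>H\<close> at \<open>p\<close>.
\<close>

definition centroaffine_metric :: "'a::euclidean_space set \<Rightarrow> 'a \<Rightarrow> 'a \<Rightarrow> 'a \<Rightarrow> real" where
  "centroaffine_metric H p v w =
     (THE c. \<forall>W Y. p \<in> W \<and> smooth_on Y W \<and> (\<forall>q\<in>H \<inter> W. Y q \<in> tangent_space H q) \<and> Y p = w \<longrightarrow>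
        frechet_derivative Y (at p) v - c *\<^sub>R p \<in> tangent_space H p)"

definition hyperbolic :: "'a::euclidean_space set \<Rightarrow> bool" where
  "hyperbolic H \<longleftrightarrow>
     (\<forall>p\<in>H. \<forall>v\<in>tangent_space H p. v \<noteq> 0 \<longrightarrow> centroaffine_metric H p v v > 0)"


section \<open>Regular boundary behaviour\<close>

definition cone_over :: "'a::euclidean_space set \<Rightarrow> 'a set" where
  "cone_over H = {t *\<^sub>R x | t x. t > 0 \<and> x \<in> H}"

definition homogeneous_on :: "'a::euclidean_space set \<Rightarrow> real \<Rightarrow> ('a \<Rightarrow> real) \<Rightarrow> bool" where
  "homogeneous_on V k h \<longleftrightarrow>
     (\<forall>x\<in>V. (\<Sum>b\<in>Basis. (x \<bullet> b) * frechet_derivative h (at x) b) = k * h x)"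

definition hess :: "('a::euclidean_space \<Rightarrow> real) \<Rightarrow> 'a \<Rightarrow> 'a \<Rightarrow> 'a \<Rightarrow> real" where
  "hess h p v w = frechet_derivative (\<lambda>q. frechet_derivative h (at q) w) (at p) v"

text \<open>
  Since \<open>0\<close> is a tangent vector at every point, \<open>0 \<notin> H\<close> for centroaffine \<open>H\<close>; hence
  \<open>cone_over H \<subseteq> V\<close> below, and the one function \<open>h\<close> is both the defining function on
  \<open>cone_over H\<close> and its extension to \<open>V\<close>.
\<close>

definition regular_boundary_behaviour :: "'a::euclidean_space set \<Rightarrow> bool" where
  "regular_boundary_behaviour H \<longleftrightarrow>
     (\<exists>(k::real) h V.
        k > 1 \<and> open V \<and> closure (cone_over H) - {0} \<subseteq> V \<and>
        smooth_on h V \<and> homogeneous_on V k h \<and>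
        H = {p \<in> cone_over H. h p = 1} \<and>
        (\<forall>p\<in>frontier (cone_over H) - {0}.
           frechet_derivative h (at p) \<noteq> (\<lambda>v. 0) \<and>
           (let T = tangent_space (frontier (cone_over H) - {0}) p in
              (\<forall>v\<in>T. - hess h p v v \<ge> 0) \<and>
              dim {v \<in> T. \<forall>w\<in>T. - hess h p v w = 0} = 1)))"

end

theory Submission
  imports Defs
begin

text \<open>
  Let \<open>U\<close> be the cone over \<open>H\<close>. Differentiating \<open>dh(Y) = 0\<close> for tangent fields \<open>Y\<close>, and using
  Euler's identity \<open>dh\<^sub>x(x) = k h(x)\<close>, identifies the centroaffine metric with \<open>-\<nabla>\<^sup>2h / k\<close> on
  \<open>T\<^sub>xH = ker dh\<^sub>x\<close> (\<open>centroaffine_metric_eq\<close>). Completeness then rests on the behaviour of the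
  metric at infinity.

  Write a point of \<open>H\<close> as \<open>x = r u\<close> with \<open>|u| = 1\<close>. Then \<open>h(u) = r\<^bsup>-k\<^esup>\<close>, so that \<open>u\<close> approaches the
  zero set of \<open>h\<close> on the compact set of unit vectors in the closed cone as \<open>x\<close> goes to infinity.
  That zero set is the boundary, and regular boundary behaviour says that \<open>-\<nabla>\<^sup>2h\<close> is positive
  definite there on \<open>ker dh\<^sub>u\<close> modulo the radial line (\<open>boundary_hess_neg\<close>). By compactness
  \<open>-\<nabla>\<^sup>2h\<^sub>u(w, w) \<ge> -C dh\<^sub>u(w)\<^sup>2\<close> for \<open>w\<close> orthogonal to \<open>u\<close> and \<open>u\<close> near the boundary
  (\<open>hess_bound_near_boundary\<close>). For a tangent vector \<open>v = w + a u\<close> the number \<open>dh\<^sub>u(w)\<close> equals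
  \<open>-a k h(u)\<close>, so the possible negative contribution of \<open>w\<close> is quadratic in the small number
  \<open>h(u)\<close>, while the radial part contributes \<open>a\<^sup>2 k (k - 1) h(u)\<close>, which is linear in it and positive
  as \<open>k > 1\<close>. The outcome is that far out on \<open>H\<close> the metric dominates a positive multiple of
  \<open>(d log |x|)\<^sup>2\<close> (\<open>metric_ge_radial\<close>). A curve of finite centroaffine length therefore stays
  bounded (\<open>curves_bounded\<close>).

  Euclidean completeness makes \<open>H\<close> a closed subset of the ambient space (\<open>closed_H\<close>), so bounded
  parts of \<open>H\<close> are relatively compact in \<open>H\<close> and the centroaffine metric, positive definite by
  hyperbolicity, is comparable with the Euclidean one on them (\<open>metric_bounds_on_cball\<close>). A
  Cauchy sequence for the centroaffine distance is thus bounded, then Cauchy in the ambient space,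
  and its limit lies in \<open>H\<close>; near the limit short curves in \<open>H\<close> realise the convergence for the
  centroaffine distance as well (\<open>dist_to_limit\<close>).

  Tangent spaces are defined by smooth curves, so the argument needs the whole of \<open>ker dh\<close> to be
  realised by curves, both in \<open>H\<close> and in the boundary of \<open>U\<close>. Such curves come from charts that
  straighten the level sets of \<open>h\<close> (\<open>level_chart_exists\<close>); at the boundary one also has to see
  that \<open>U\<close> fills all of one side of its boundary locally (\<open>tangent_space_frontier\<close>).
\<close>

abbreviation D :: "('a::euclidean_space \<Rightarrow> 'b::real_normed_vector) \<Rightarrow> 'a \<Rightarrow> 'a \<Rightarrow> 'b"
  where "D f x \<equiv> frechet_derivative f (at x)"

section \<open>Smooth maps\<close>

lemma D_eqI: "(f has_derivative f') (at x) \<Longrightarrow> D f x = f'"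
  using frechet_derivative_at by metis

lemma D_cong_open:
  assumes "open S" "x \<in> S" "\<And>y. y \<in> S \<Longrightarrow> f y = g y"
  shows "D f x = D g x"
proof -
  have "(f has_derivative f') (at x) \<longleftrightarrow> (g has_derivative f') (at x)" for f'
    using assms has_derivative_transform_within_open[of f f' x UNIV S g]
      has_derivative_transform_within_open[of g f' x UNIV S f] by auto
  then show ?thesis unfolding frechet_derivative_def by simp
qed

lemma Ck_on_cong:
  assumes "open S" "\<And>x. x \<in> S \<Longrightarrow> f x = g x"
  shows "Ck_on k f S \<longleftrightarrow> Ck_on k g S"
  using assms(2)
proof (induction k arbitrary: f g)
  case 0
  then show ?case by (simp cong: continuous_on_cong)
next
  case (Suc k)
  have "D f x = D g x" if "x \<in> S" for x
    using D_cong_open[OF assms(1) that] Suc.prems by blast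
  then have "Ck_on k (\<lambda>x. D f x v) S = Ck_on k (\<lambda>x. D g x v) S" for v
    by (intro Suc.IH) simp
  moreover have "f differentiable_on S \<longleftrightarrow> g differentiable_on S"
    unfolding differentiable_on_def using Suc.prems
    by (metis differentiable_transform_within zero_less_one)
  ultimately show ?case unfolding Ck_on.simps by blast
qed

lemma Ck_on_SucI:
  assumes "open S" "\<And>x. x \<in> S \<Longrightarrow> (f has_derivative f' x) (at x)" "\<And>v. Ck_on k (\<lambda>x. f' x v) S"
  shows "Ck_on (Suc k) f S"
proof -
  have "f differentiable_on S"
    unfolding differentiable_on_def differentiable_def
    using assms(2) has_derivative_at_withinI by blast
  moreover have "Ck_on k (\<lambda>x. D f x v) S" for v
  proof -
    have "D f x v = f' x v" if "x \<in> S" for x using D_eqI[OF assms(2)[OF that]] by simp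
    then have "Ck_on k (\<lambda>x. D f x v) S = Ck_on k (\<lambda>x. f' x v) S" by (rule Ck_on_cong[OF assms(1)])
    then show ?thesis using assms(3) by blast
  qed
  ultimately show ?thesis unfolding Ck_on.simps by blast
qed

lemma Ck_on_has_derivative:
  assumes "open S" "Ck_on (Suc k) f S" "x \<in> S"
  shows "(f has_derivative D f x) (at x)"
  using assms by (auto simp: differentiable_on_eq_differentiable_at frechet_derivative_works)

lemma Ck_on_Suc_imp: "Ck_on (Suc k) f S \<Longrightarrow> Ck_on k f S"
proof (induction k arbitrary: f)
  case 0
  then show ?case by (simp add: differentiable_imp_continuous_on)
next
  case (Suc k)
  then have "Ck_on (Suc k) (\<lambda>x. D f x v) S" for v by simp
  then have "Ck_on k (\<lambda>x. D f x v) S" for v using Suc.IH by blast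
  then show ?case using Suc.prems by simp
qed

lemma Ck_on_const: "open S \<Longrightarrow> Ck_on k (\<lambda>x. c) S"
proof (induction k arbitrary: c)
  case (Suc k)
  show ?case by (rule Ck_on_SucI[where f' = "\<lambda>x v. 0"]) (use Suc in auto)
qed simp

lemma Ck_on_add: "open S \<Longrightarrow> Ck_on k f S \<Longrightarrow> Ck_on k g S \<Longrightarrow> Ck_on k (\<lambda>x. f x + g x) S"
proof (induction k arbitrary: f g)
  case 0
  then show ?case by (auto intro: continuous_intros)
next
  case (Suc k)
  have "Ck_on k (\<lambda>x. D f x v + D g x v) S" for v using Suc by simp
  then show ?case
    by (intro Ck_on_SucI[where f' = "\<lambda>x v. D f x v + D g x v"] has_derivative_add
          Ck_on_has_derivative[OF Suc.prems(1,2)] Ck_on_has_derivative[OF Suc.prems(1,3)] Suc.prems(1))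
qed

lemma Ck_on_sum:
  "finite I \<Longrightarrow> open S \<Longrightarrow> (\<And>i. i \<in> I \<Longrightarrow> Ck_on k (f i) S) \<Longrightarrow> Ck_on k (\<lambda>x. \<Sum>i\<in>I. f i x) S"
  by (induction I rule: finite_induct) (auto intro: Ck_on_const Ck_on_add)

lemma Ck_on_bilinear:
  assumes "bounded_bilinear mul" "open S"
  shows "Ck_on k f S \<Longrightarrow> Ck_on k g S \<Longrightarrow> Ck_on k (\<lambda>x. mul (f x) (g x)) S"
proof (induction k arbitrary: f g)
  case 0
  then show ?case using bounded_bilinear.continuous_on[OF assms(1)] by auto
next
  case (Suc k)
  have "Ck_on k (\<lambda>x. mul (f x) (D g x v) + mul (D f x v) (g x)) S" for v
    by (intro Ck_on_add Suc.IH \<open>open S\<close> Suc.prems[THEN Ck_on_Suc_imp])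
      (use Suc.prems in auto)
  then show ?case
    by (intro Ck_on_SucI[where f' = "\<lambda>x v. mul (f x) (D g x v) + mul (D f x v) (g x)"] \<open>open S\<close>
              bounded_bilinear.FDERIV[OF assms(1)] Ck_on_has_derivative[OF \<open>open S\<close> Suc.prems(1)]
              Ck_on_has_derivative[OF \<open>open S\<close> Suc.prems(2)])
qed

lemma Ck_on_linear:
  assumes "bounded_linear L" "open S"
  shows "Ck_on k L S"
proof (cases k)
  case 0
  then show ?thesis using bounded_linear.continuous_on[OF assms(1) continuous_on_id] by simp
next
  case (Suc j)
  show ?thesis unfolding Suc
    by (rule Ck_on_SucI[where f' = "\<lambda>x. L"])
       (use assms bounded_linear_imp_has_derivative Ck_on_const in auto)
qed

lemma Ck_on_compose:
  fixes f :: "'b::euclidean_space \<Rightarrow> 'c::real_normed_vector" and g :: "'a::euclidean_space \<Rightarrow> 'b"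
  assumes "open S" "open T" "g ` S \<subseteq> T"
  shows "Ck_on k f T \<Longrightarrow> Ck_on k g S \<Longrightarrow> Ck_on k (\<lambda>x. f (g x)) S"
proof (induction k arbitrary: f)
  case 0
  then show ?case using assms continuous_on_compose2 by (metis Ck_on.simps(1))
next
  case (Suc k)
  have df: "(f has_derivative D f y) (at y)" if "y \<in> T" for y
    using Ck_on_has_derivative[OF assms(2) Suc.prems(1) that] .
  have dg: "(g has_derivative D g x) (at x)" if "x \<in> S" for x
    using Ck_on_has_derivative[OF assms(1) Suc.prems(2) that] .
  let ?f' = "\<lambda>x v. \<Sum>b\<in>Basis. (D g x v \<bullet> b) *\<^sub>R D f (g x) b"
  have eq: "D f (g x) (D g x v) = ?f' x v" if "x \<in> S" for x v
  proof -
    interpret bounded_linear "D f (g x)" using df that assms(3) has_derivative_bounded_linear by blast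
    have "D f (g x) (D g x v) = D f (g x) (\<Sum>b\<in>Basis. (D g x v \<bullet> b) *\<^sub>R b)"
      by (simp add: euclidean_representation)
    then show ?thesis by (simp add: sum scaleR)
  qed
  have "Ck_on k (\<lambda>x. D f (g x) b) S" for b
  proof -
    have "Ck_on k (\<lambda>y. D f y b) T" using Suc.prems(1) by simp
    then show ?thesis using Suc.IH Ck_on_Suc_imp[OF Suc.prems(2)] by blast
  qed
  moreover have "Ck_on k (\<lambda>x. D g x v \<bullet> b) S" for v b
  proof -
    have "Ck_on k (\<lambda>x. D g x v) S" using Suc.prems by simp
    then show ?thesis
      using Ck_on_bilinear[OF bounded_bilinear_inner assms(1) _ Ck_on_const[OF assms(1)]] by blast
  qed
  ultimately have *: "Ck_on k (\<lambda>x. ?f' x v) S" for v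
    by (intro Ck_on_sum Ck_on_bilinear[OF bounded_bilinear_scaleR assms(1)] assms(1) finite_Basis) auto
  show ?case
  proof (rule Ck_on_SucI[OF assms(1)])
    show "((\<lambda>x. f (g x)) has_derivative (\<lambda>v. ?f' x v)) (at x)" if "x \<in> S" for x
      using has_derivative_compose[OF dg[OF that] df[of "g x"]] eq[OF that] that assms(3) by auto
  qed (use * assms in auto)
qed

lemma Ck_on_inverse:
  fixes f :: "'a::euclidean_space \<Rightarrow> real"
  assumes "open S" "\<And>x. x \<in> S \<Longrightarrow> f x \<noteq> 0"
  shows "Ck_on k f S \<Longrightarrow> Ck_on k (\<lambda>x. inverse (f x)) S"
proof (induction k)
  case 0
  then show ?case using assms by (auto intro: continuous_intros)
next
  case (Suc k)
  have i: "Ck_on k (\<lambda>x. inverse (f x)) S" using Suc Ck_on_Suc_imp by blast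
  have "Ck_on k (\<lambda>x. (- inverse (f x) * inverse (f x)) * D f x v) S" for v
  proof -
    have "Ck_on k (\<lambda>x. -1 * (inverse (f x) * (inverse (f x) * D f x v))) S"
      using Suc.prems i
      by (intro Ck_on_bilinear[OF bounded_bilinear_mult] assms i Ck_on_const) auto
    then show ?thesis by (simp add: mult.assoc)
  qed
  then have *: "Ck_on k (\<lambda>x. - (inverse (f x) * D f x v * inverse (f x))) S" for v
    by (simp add: mult_ac)
  show ?case
  proof (rule Ck_on_SucI[OF assms(1) _ *])
    show "((\<lambda>x. inverse (f x)) has_derivative (\<lambda>v. - (inverse (f x) * D f x v * inverse (f x)))) (at x)"
      if "x \<in> S" for x
      using Deriv.has_derivative_inverse[OF assms(2) Ck_on_has_derivative[OF assms(1) Suc.prems]] that by blast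
  qed
qed

lemma Ck_on_subset: "Ck_on k f S \<Longrightarrow> T \<subseteq> S \<Longrightarrow> Ck_on k f T"
proof (induction k arbitrary: f)
  case 0
  then show ?case using continuous_on_subset by auto
next
  case (Suc k)
  then show ?case unfolding Ck_on.simps using differentiable_on_subset by blast
qed

lemma smooth_on_subset: "smooth_on f S \<Longrightarrow> open T \<Longrightarrow> T \<subseteq> S \<Longrightarrow> smooth_on f T"
  unfolding smooth_on_def using Ck_on_subset by blast

lemma smooth_onD: "smooth_on f S \<Longrightarrow> open S" "smooth_on f S \<Longrightarrow> Ck_on k f S"
  by (auto simp: smooth_on_def)

lemma smooth_on_const: "open S \<Longrightarrow> smooth_on (\<lambda>x. c) S"
  by (simp add: smooth_on_def Ck_on_const)

lemma smooth_on_has_derivative: "smooth_on f S \<Longrightarrow> x \<in> S \<Longrightarrow> (f has_derivative D f x) (at x)"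
  by (meson smooth_on_def Ck_on_has_derivative)

lemma smooth_on_linear_D: "smooth_on f S \<Longrightarrow> x \<in> S \<Longrightarrow> linear (D f x)"
  using smooth_on_has_derivative has_derivative_linear by blast

lemma smooth_on_D: "smooth_on f S \<Longrightarrow> smooth_on (\<lambda>x. D f x v) S"
  unfolding smooth_on_def by (metis Ck_on.simps(2))

lemma smooth_on_continuous: "smooth_on f S \<Longrightarrow> continuous_on S f"
  unfolding smooth_on_def by (metis Ck_on.simps(1))

text \<open>Bootstrapping: the differential equation turns \<open>k\<close> continuous derivatives of the curve into
  \<open>k + 1\<close> of them.\<close>

lemma smooth_on_integral_curve:
  fixes X :: "'a::euclidean_space \<Rightarrow> 'a" and \<gamma> :: "real \<Rightarrow> 'a"
  assumes "open I" "smooth_on X S" "\<gamma> ` I \<subseteq> S"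
    and deriv: "\<And>t. t \<in> I \<Longrightarrow> (\<gamma> has_vector_derivative X (\<gamma> t)) (at t)"
  shows "smooth_on \<gamma> I"
proof -
  have "Ck_on k \<gamma> I" for k
  proof (induction k)
    case 0
    then show ?case
      by (simp add: continuous_at_imp_continuous_on has_vector_derivative_continuous[OF deriv])
  next
    case (Suc k)
    have "Ck_on k (\<lambda>t. X (\<gamma> t)) I"
      using Ck_on_compose[OF assms(1) smooth_onD(1)[OF assms(2)] assms(3) smooth_onD(2)[OF assms(2)] Suc] .
    then have "Ck_on k (\<lambda>t. v *\<^sub>R X (\<gamma> t)) I" for v :: real
      using Ck_on_bilinear[OF bounded_bilinear_scaleR assms(1) Ck_on_const[OF assms(1)]] by blast
    then show ?case
      by (intro Ck_on_SucI[where f' = "\<lambda>t v. v *\<^sub>R X (\<gamma> t)"] assms(1))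
         (use deriv in \<open>auto simp: has_vector_derivative_def\<close>)
  qed
  then show ?thesis using assms(1) by (simp add: smooth_on_def)
qed

section \<open>The second derivative\<close>

text \<open>The mean value theorem, applied first in direction \<open>w\<close> and then in direction \<open>v\<close>, turns the
  second difference into a value of the second derivative at a nearby point. Since the second
  difference is symmetric in \<open>v\<close> and \<open>w\<close>, this is what makes the Hessian symmetric.\<close>

lemma hess_second_difference:
  fixes h :: "'a::euclidean_space \<Rightarrow> real"
  assumes h: "smooth_on h S" and p: "p \<in> S" and c: "0 < c"
  shows "\<exists>\<delta>>0. \<forall>\<epsilon>. 0 < \<epsilon> \<and> \<epsilon> < \<delta> \<longrightarrow>
    \<bar>(h (p + \<epsilon> *\<^sub>R v + \<epsilon> *\<^sub>R w) - h (p + \<epsilon> *\<^sub>R v) - h (p + \<epsilon> *\<^sub>R w) + h p) / \<epsilon>\<^sup>2 - hess h p v w\<bar> < c"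
proof -
  have S: "open S" using h smooth_onD by blast
  have dw: "smooth_on (\<lambda>q. D h q w) S" using h smooth_on_D by blast
  have cont: "continuous_on S (\<lambda>q. hess h q v w)"
    unfolding hess_def using dw smooth_on_D smooth_on_continuous by blast
  obtain r where r: "r > 0" "ball p r \<subseteq> S" "\<And>q. q \<in> ball p r \<Longrightarrow> \<bar>hess h q v w - hess h p v w\<bar> < c"
  proof -
    obtain r1 where r1: "r1 > 0" "ball p r1 \<subseteq> S" using S p openE by blast
    obtain r2 where r2: "r2 > 0" "\<And>q. q \<in> S \<Longrightarrow> dist q p < r2 \<Longrightarrow> dist (hess h q v w) (hess h p v w) < c"
      using cont p c unfolding continuous_on_iff by blast
    show ?thesis
    proof (rule that[of "min r1 r2"])
      show "\<bar>hess h q v w - hess h p v w\<bar> < c" if "q \<in> ball p (min r1 r2)" for q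
        using that r1(2) r2(2)[of q] by (simp add: subset_iff dist_real_def dist_commute)
      show "ball p (min r1 r2) \<subseteq> S" using r1(2) subset_ball[of "min r1 r2" r1 p] by simp
      show "min r1 r2 > 0" using r1(1) r2(1) by simp
    qed
  qed
  (* keeps the parallelogram with sides \<open>\<epsilon> v\<close>, \<open>\<epsilon> w\<close> inside the ball when \<open>\<epsilon> < \<delta>\<close> *)
  define \<delta> where "\<delta> = r / (norm v + norm w + 1)"
  have \<delta>: "\<delta> > 0" unfolding \<delta>_def using r(1) by (simp add: add_nonneg_pos)
  have inball: "p + s *\<^sub>R v + t *\<^sub>R w \<in> ball p r"
    if "0 \<le> s" "s \<le> \<epsilon>" "0 \<le> t" "t \<le> \<epsilon>" "\<epsilon> < \<delta>" for s t \<epsilon>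
  proof -
    have "norm (s *\<^sub>R v + t *\<^sub>R w) \<le> s * norm v + t * norm w"
      using that norm_triangle_ineq[of "s *\<^sub>R v" "t *\<^sub>R w"] by simp
    also have "\<dots> \<le> \<epsilon> * norm v + \<epsilon> * norm w" using that by (intro add_mono mult_right_mono) auto
    also have "\<dots> \<le> \<epsilon> * (norm v + norm w + 1)" using that by (simp add: algebra_simps)
    also have "\<dots> < \<delta> * (norm v + norm w + 1)"
      using that by (intro mult_strict_right_mono) (auto simp: add_nonneg_pos)
    also have "\<dots> = r" unfolding \<delta>_def using add_nonneg_pos[of "norm v + norm w" 1] by simp
    finally show ?thesis by (simp add: dist_norm norm_minus_commute algebra_simps)
  qed
  have "\<bar>(h (p + \<epsilon> *\<^sub>R v + \<epsilon> *\<^sub>R w) - h (p + \<epsilon> *\<^sub>R v) - h (p + \<epsilon> *\<^sub>R w) + h p) / \<epsilon>\<^sup>2 - hess h p v w\<bar> < c"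
    if \<epsilon>: "0 < \<epsilon>" "\<epsilon> < \<delta>" for \<epsilon>
  proof -
    let ?f = "\<lambda>t. h (p + \<epsilon> *\<^sub>R v + t *\<^sub>R w) - h (p + 0 *\<^sub>R v + t *\<^sub>R w)"
    have dh: "((\<lambda>t. h (p + s *\<^sub>R v + t *\<^sub>R w)) has_real_derivative D h (p + s *\<^sub>R v + t *\<^sub>R w) w) (at t)"
      if "0 \<le> s" "s \<le> \<epsilon>" "0 \<le> t" "t \<le> \<epsilon>" for s t
    proof -
      have q: "p + s *\<^sub>R v + t *\<^sub>R w \<in> S" using inball[OF that \<epsilon>(2)] r by blast
      have "((\<lambda>t. p + s *\<^sub>R v + t *\<^sub>R w) has_derivative (\<lambda>d. d *\<^sub>R w)) (at t)"
        by (auto intro!: derivative_eq_intros)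
      from has_derivative_compose[OF this smooth_on_has_derivative[OF h q]]
      show ?thesis unfolding has_field_derivative_def
        using linear_cmul[OF smooth_on_linear_D[OF h q]] by (simp add: mult.commute[of _ "D h _ w"])
    qed
    have "\<exists>t>0. t < \<epsilon> \<and> ?f \<epsilon> - ?f 0
      = (\<epsilon> - 0) * (D h (p + \<epsilon> *\<^sub>R v + t *\<^sub>R w) w - D h (p + 0 *\<^sub>R v + t *\<^sub>R w) w)"
      using \<epsilon> by (intro MVT2 DERIV_diff dh) auto
    then obtain t where t: "0 < t" "t < \<epsilon>" and ft: "?f \<epsilon> - ?f 0
      = \<epsilon> * (D h (p + \<epsilon> *\<^sub>R v + t *\<^sub>R w) w - D h (p + 0 *\<^sub>R v + t *\<^sub>R w) w)" by auto
    have dh2: "((\<lambda>s. D h (p + s *\<^sub>R v + t *\<^sub>R w) w) has_real_derivative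
        hess h (p + s *\<^sub>R v + t *\<^sub>R w) v w) (at s)" if "0 \<le> s" "s \<le> \<epsilon>" for s
    proof -
      have q: "p + s *\<^sub>R v + t *\<^sub>R w \<in> S" using inball[OF that _ _ \<epsilon>(2), of t] r t by auto
      have "((\<lambda>s. p + s *\<^sub>R v + t *\<^sub>R w) has_derivative (\<lambda>d. d *\<^sub>R v)) (at s)"
        by (auto intro!: derivative_eq_intros)
      from has_derivative_compose[OF this smooth_on_has_derivative[OF dw q]]
      show ?thesis unfolding has_field_derivative_def hess_def
        using linear_cmul[OF smooth_on_linear_D[OF dw q]] by (simp add: mult.commute[of _ "D _ _ v"])
    qed
    obtain s where s: "0 < s" "s < \<epsilon>" and fs: "D h (p + \<epsilon> *\<^sub>R v + t *\<^sub>R w) w - D h (p + 0 *\<^sub>R v + t *\<^sub>R w) w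
      = \<epsilon> * hess h (p + s *\<^sub>R v + t *\<^sub>R w) v w"
      using MVT2[of 0 \<epsilon> "\<lambda>s. D h (p + s *\<^sub>R v + t *\<^sub>R w) w" "\<lambda>s. hess h (p + s *\<^sub>R v + t *\<^sub>R w) v w"] \<epsilon> dh2
      by auto
    have "(h (p + \<epsilon> *\<^sub>R v + \<epsilon> *\<^sub>R w) - h (p + \<epsilon> *\<^sub>R v) - h (p + \<epsilon> *\<^sub>R w) + h p) / \<epsilon>\<^sup>2
        = hess h (p + s *\<^sub>R v + t *\<^sub>R w) v w"
      using ft fs \<epsilon> by (simp add: power2_eq_square field_simps)
    moreover have "p + s *\<^sub>R v + t *\<^sub>R w \<in> ball p r" using inball[of s \<epsilon> t] s t \<epsilon> by auto
    ultimately show ?thesis using r(3) by metis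
  qed
  then show ?thesis using \<delta> by blast
qed

lemma hess_commute:
  fixes h :: "'a::euclidean_space \<Rightarrow> real"
  assumes "smooth_on h S" "p \<in> S"
  shows "hess h p v w = hess h p w v"
proof (rule ccontr)
  assume ne: "\<not> ?thesis"
  define c where "c = \<bar>hess h p v w - hess h p w v\<bar> / 2"
  have c: "c > 0" using ne by (simp add: c_def)
  let ?d = "\<lambda>v w \<epsilon>. (h (p + \<epsilon> *\<^sub>R v + \<epsilon> *\<^sub>R w) - h (p + \<epsilon> *\<^sub>R v) - h (p + \<epsilon> *\<^sub>R w) + h p) / \<epsilon>\<^sup>2"
  obtain \<delta>1 where d1: "\<delta>1 > 0" "\<And>\<epsilon>. 0 < \<epsilon> \<Longrightarrow> \<epsilon> < \<delta>1 \<Longrightarrow> \<bar>?d v w \<epsilon> - hess h p v w\<bar> < c"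
    using hess_second_difference[OF assms c, of v w] by blast
  obtain \<delta>2 where d2: "\<delta>2 > 0" "\<And>\<epsilon>. 0 < \<epsilon> \<Longrightarrow> \<epsilon> < \<delta>2 \<Longrightarrow> \<bar>?d w v \<epsilon> - hess h p w v\<bar> < c"
    using hess_second_difference[OF assms c, of w v] by blast
  define \<epsilon> where "\<epsilon> = min \<delta>1 \<delta>2 / 2"
  have \<epsilon>: "0 < \<epsilon>" "\<epsilon> < \<delta>1" "\<epsilon> < \<delta>2" using d1 d2 by (auto simp: \<epsilon>_def)
  have sym: "?d v w \<epsilon> = ?d w v \<epsilon>" by (simp add: algebra_simps)
  define A where "A = ?d v w \<epsilon>"
  have "\<bar>A - hess h p v w\<bar> < c" unfolding A_def by (rule d1(2)[OF \<epsilon>(1,2)])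
  moreover have "\<bar>A - hess h p w v\<bar> < c" unfolding A_def sym by (rule d2(2)[OF \<epsilon>(1,3)])
  moreover have "\<bar>hess h p v w - hess h p w v\<bar> \<le> \<bar>A - hess h p v w\<bar> + \<bar>A - hess h p w v\<bar>"
    by linarith
  moreover have "\<bar>hess h p v w - hess h p w v\<bar> = 2 * c" by (simp add: c_def)
  ultimately show False by linarith
qed

lemma hess_linear_left:
  assumes "smooth_on h S" "p \<in> S"
  shows "linear (\<lambda>v. hess h p v w)"
  unfolding hess_def using smooth_on_linear_D[OF smooth_on_D[OF assms(1)] assms(2)] by simp

lemma hess_linear_right:
  assumes "smooth_on h S" "p \<in> S"
  shows "linear (hess h p v)"
proof -
  have "hess h p v = (\<lambda>w. hess h p w v)" using hess_commute[OF assms] by blast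
  then show ?thesis using hess_linear_left[OF assms] by simp
qed

lemma D_representation:
  assumes "smooth_on h S" "p \<in> S"
  shows "D h p v = (\<Sum>b\<in>Basis. (v \<bullet> b) *\<^sub>R D h p b)"
proof -
  have "D h p v = D h p (\<Sum>b\<in>Basis. (v \<bullet> b) *\<^sub>R b)" by (simp add: euclidean_representation)
  then show ?thesis
    using smooth_on_linear_D[OF assms] by (simp add: linear_sum linear_cmul)
qed

lemma hess_representation:
  assumes "smooth_on h S" "p \<in> S"
  shows "hess h p v w = (\<Sum>b\<in>Basis. \<Sum>c\<in>Basis. (v \<bullet> b) * ((w \<bullet> c) * hess h p b c))"
proof -
  have l: "hess h p v w = (\<Sum>b\<in>Basis. (v \<bullet> b) * hess h p b w)" for v w
    using D_representation[OF smooth_on_D[OF assms(1)] assms(2), of w v]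
    unfolding hess_def real_scaleR_def .
  have "hess h p b w = (\<Sum>c\<in>Basis. (w \<bullet> c) * hess h p b c)" for b
    unfolding hess_commute[OF assms, of b w] l[of w b]
    by (intro sum.cong refl arg_cong2[where f = "(*)"] hess_commute[OF assms])
  then show ?thesis by (subst l) (simp add: sum_distrib_left)
qed

lemma continuous_on_D_pair:
  fixes h :: "'a::euclidean_space \<Rightarrow> 'b::real_normed_vector" and q v :: "'c::topological_space \<Rightarrow> 'a"
  assumes "smooth_on h S" "continuous_on A q" "q ` A \<subseteq> S" "continuous_on A v"
  shows "continuous_on A (\<lambda>x. D h (q x) (v x))"
proof -
  have "continuous_on A (\<lambda>x. D h (q x) b)" for b
    using continuous_on_compose2[OF smooth_on_continuous[OF smooth_on_D[OF assms(1)]] assms(2,3)] .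
  then have "continuous_on A (\<lambda>x. \<Sum>b\<in>Basis. (v x \<bullet> b) *\<^sub>R D h (q x) b)"
    using assms(4) by (auto intro!: continuous_intros)
  moreover have "D h (q x) (v x) = (\<Sum>b\<in>Basis. (v x \<bullet> b) *\<^sub>R D h (q x) b)" if "x \<in> A" for x
    using D_representation[OF assms(1)] assms(3) that by blast
  ultimately show ?thesis by (simp cong: continuous_on_cong)
qed

lemma continuous_on_hess:
  fixes h :: "'a::euclidean_space \<Rightarrow> real" and q v w :: "'c::topological_space \<Rightarrow> 'a"
  assumes "smooth_on h S" "continuous_on A q" "q ` A \<subseteq> S" "continuous_on A v" "continuous_on A w"
  shows "continuous_on A (\<lambda>x. hess h (q x) (v x) (w x))"
proof -
  have "continuous_on A (\<lambda>x. hess h (q x) b c)" for b c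
    unfolding hess_def
    using continuous_on_compose2[OF smooth_on_continuous[OF smooth_on_D[OF smooth_on_D[OF assms(1)]]] assms(2,3)] .
  then have "continuous_on A (\<lambda>x. \<Sum>b\<in>Basis. \<Sum>c\<in>Basis. (v x \<bullet> b) * ((w x \<bullet> c) * hess h (q x) b c))"
    using assms(4,5) by (auto intro!: continuous_intros)
  moreover have "hess h (q x) (v x) (w x)
    = (\<Sum>b\<in>Basis. \<Sum>c\<in>Basis. (v x \<bullet> b) * ((w x \<bullet> c) * hess h (q x) b c))" if "x \<in> A" for x
    using hess_representation[OF assms(1)] assms(3) that by blast
  ultimately show ?thesis by (simp cong: continuous_on_cong)
qed

lemma D_real_representation:
  fixes h :: "'a::euclidean_space \<Rightarrow> real"
  assumes "smooth_on h V" "p \<in> V"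
  shows "D h p v = (\<Sum>b\<in>Basis. (v \<bullet> b) * D h p b)"
  using D_representation[OF assms] unfolding real_scaleR_def .

text \<open>The product rule for the pairing of \<open>dh\<close> with a vector field. Radial identities for the Hessian
  come from \<open>Y q = q\<close>, the Gauss formula from fields tangent to a level set.\<close>

lemma has_derivative_D_field:
  fixes h :: "'a::euclidean_space \<Rightarrow> real"
  assumes h: "smooth_on h V" and p: "p \<in> V" and Y: "(Y has_derivative Y') (at p)"
  shows "((\<lambda>q. D h q (Y q)) has_derivative (\<lambda>v. hess h p v (Y p) + D h p (Y' v))) (at p)"
proof -
  have "((\<lambda>q. \<Sum>b\<in>Basis. (Y q \<bullet> b) * D h q b) has_derivative
      (\<lambda>v. \<Sum>b\<in>Basis. (Y p \<bullet> b) * hess h p v b + (Y' v \<bullet> b) * D h p b)) (at p)"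
    unfolding hess_def
    by (intro has_derivative_sum has_derivative_mult has_derivative_inner_left Y
        smooth_on_has_derivative[OF smooth_on_D[OF h] p])
  then have "((\<lambda>q. D h q (Y q)) has_derivative
      (\<lambda>v. \<Sum>b\<in>Basis. (Y p \<bullet> b) * hess h p v b + (Y' v \<bullet> b) * D h p b)) (at p)"
    by (rule has_derivative_transform_within_open[OF _ smooth_onD(1)[OF h] p])
       (rule D_real_representation[OF h, symmetric])
  moreover have "(\<Sum>b\<in>Basis. (Y p \<bullet> b) * hess h p v b + (Y' v \<bullet> b) * D h p b)
      = hess h p v (Y p) + D h p (Y' v)" for v
  proof -
    have "hess h p v (Y p) = (\<Sum>b\<in>Basis. (Y p \<bullet> b) * hess h p b v)"
      unfolding hess_commute[OF h p, of v "Y p"] unfolding hess_def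
      by (rule D_real_representation[OF smooth_on_D[OF h] p])
    moreover have "D h p (Y' v) = (\<Sum>b\<in>Basis. (Y' v \<bullet> b) * D h p b)"
      by (rule D_real_representation[OF h p])
    ultimately show ?thesis by (simp only: sum.distrib hess_commute[OF h p, of v])
  qed
  ultimately show ?thesis by simp
qed

section \<open>Straightening a regular level set\<close>

text \<open>The projection of \<open>w\<close> to the kernel of \<open>dh\<close> along \<open>\<nu>\<close>. In the charts below, straight lines
  with direction \<open>w\<close> correspond to integral curves of this field.\<close>

definition level_field :: "('a::euclidean_space \<Rightarrow> real) \<Rightarrow> 'a \<Rightarrow> 'a \<Rightarrow> 'a \<Rightarrow> 'a" where
  "level_field h \<nu> w q = w - (D h q w / D h q \<nu>) *\<^sub>R \<nu>"

text \<open>A chart \<open>G\<close> with inverse \<open>F\<close> onto a ball in which \<open>h\<close> becomes the linear form \<open>dh\<^sub>p\<close>, so that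
  level sets of \<open>h\<close> become pieces of hyperplanes. The constant \<open>C\<close> bounds the distortion of
  lengths along these level sets.\<close>

locale level_chart =
  fixes h :: "'a::euclidean_space \<Rightarrow> real" and p :: 'a and N :: "'a set" and r :: real
    and G F :: "'a \<Rightarrow> 'a" and \<nu> :: 'a and C :: real
  assumes smooth: "smooth_on h N"
    and p_in: "p \<in> N"
    and r_pos: "r > 0"
    and C_pos: "C > 0"
    and homeo: "homeomorphism N (ball (G p) r) G F"
    and h_eq: "\<And>q. q \<in> N \<Longrightarrow> D h p (G q) = h q"
    and transversal: "\<And>q. q \<in> N \<Longrightarrow> D h q \<nu> > 0"
    and field_bound: "\<And>q w. q \<in> N \<Longrightarrow> norm (level_field h \<nu> w q) \<le> C * norm w"
    and F_deriv: "\<And>a w t. D h p w = 0 \<Longrightarrow> a + t *\<^sub>R w \<in> ball (G p) r \<Longrightarrow>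
        ((\<lambda>t. F (a + t *\<^sub>R w)) has_vector_derivative level_field h \<nu> w (F (a + t *\<^sub>R w))) (at t)"

text \<open>With \<open>l = dh\<^sub>p\<close> and \<open>l(\<nu>) = 1\<close>, the map \<open>G(q) = q + (h(q) - l(q)) \<nu>\<close> satisfies \<open>l \<circ> G = h\<close> and
  has the identity as derivative at \<open>p\<close>; the inverse function theorem provides \<open>F\<close>. Solving
  \<open>dG(v) = w\<close> for \<open>l(w) = 0\<close> gives the formula for the derivative of \<open>F\<close> in the directions
  tangent to the level sets.\<close>

lemma level_chart_exists:
  fixes h :: "'a::euclidean_space \<Rightarrow> real"
  assumes h: "smooth_on h V" and p: "p \<in> V" "D h p v0 \<noteq> 0" and W: "open W" "p \<in> W"
  obtains N r G F \<nu> C where "N \<subseteq> W \<inter> V" "level_chart h p N r G F \<nu> C"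
proof -
  define l where "l = D h p"
  have lin: "linear l" unfolding l_def using smooth_on_linear_D[OF h p(1)] .
  define \<nu> where "\<nu> = v0 /\<^sub>R l v0"
  have l\<nu>: "l \<nu> = 1" unfolding \<nu>_def using p(2) linear_cmul[OF lin, of "inverse (l v0)" v0] by (simp add: l_def)
  have V: "open V" using smooth_onD[OF h] by blast
  define G where "G = (\<lambda>q. q + (h q - l q) *\<^sub>R \<nu>)"
  define B where "B = (\<Sum>b\<in>Basis. \<bar>D h p b\<bar>) + 1"
  have B: "B \<ge> 0" unfolding B_def by (simp add: sum_nonneg)
  have contD: "continuous_on V (\<lambda>q. D h q v)" for v
    using smooth_on_continuous[OF smooth_on_D[OF h]] .
  (* the bounds on \<open>dh\<close> that make \<open>C\<close> uniform *)
  define U where "U = W \<inter> ({q\<in>V. D h q \<nu> \<in> {1/2<..}} \<inter> {q\<in>V. (\<Sum>b\<in>Basis. \<bar>D h q b\<bar>) \<in> {..<B}})"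
  have "open U" unfolding U_def
    by (intro open_Int W(1) continuous_open_preimage[OF contD V, unfolded vimage_def Int_def mem_Collect_eq]
        continuous_open_preimage[OF _ V, unfolded vimage_def Int_def mem_Collect_eq] continuous_on_sum
        continuous_on_rabs contD) auto
  have pU: "p \<in> U" unfolding U_def B_def using p(1) W(2) l\<nu> by (simp add: l_def)
  have UV: "U \<subseteq> W \<inter> V" unfolding U_def by blast
  define f' where "f' = (\<lambda>q. Blinfun (\<lambda>v. v + (D h q v - l v) *\<^sub>R \<nu>))"
  have blin: "bounded_linear (\<lambda>v. v + (D h q v - l v) *\<^sub>R \<nu>)" if "q \<in> U" for q
  proof -
    have "linear (D h q)" using smooth_on_linear_D[OF h] UV that by blast
    then have "linear (\<lambda>v. v + (D h q v - l v) *\<^sub>R \<nu>)"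
      using lin by (intro linearI) (simp_all add: linear_add linear_cmul algebra_simps)
    then show ?thesis by (simp add: linear_conv_bounded_linear)
  qed
  have f'_apply: "blinfun_apply (f' q) v = v + (D h q v - l v) *\<^sub>R \<nu>" if "q \<in> U" for q v
    unfolding f'_def by (simp add: bounded_linear_Blinfun_apply[OF blin[OF that]])
  have dG: "(G has_derivative blinfun_apply (f' q)) (at q)" if "q \<in> U" for q
  proof -
    have "(h has_derivative D h q) (at q)" using smooth_on_has_derivative[OF h] UV that by blast
    moreover have "(l has_derivative l) (at q)"
      using lin by (simp add: linear_conv_bounded_linear bounded_linear_imp_has_derivative)
    ultimately have "(G has_derivative (\<lambda>v. v + (D h q v - l v) *\<^sub>R \<nu>)) (at q)"
      unfolding G_def by (auto intro!: derivative_eq_intros)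
    moreover have "blinfun_apply (f' q) = (\<lambda>v. v + (D h q v - l v) *\<^sub>R \<nu>)"
      using f'_apply[OF that] by blast
    ultimately show ?thesis by simp
  qed
  have contf': "continuous_on U f'"
  proof (rule continuous_on_blinfun_componentwise)
    fix i :: 'a
    have "continuous_on U (\<lambda>q. i + (D h q i - l i) *\<^sub>R \<nu>)"
      using continuous_on_subset[OF contD] UV by (auto intro!: continuous_intros)
    then show "continuous_on U (\<lambda>q. blinfun_apply (f' q) i)"
      using f'_apply by (simp cong: continuous_on_cong)
  qed
  have "id_blinfun o\<^sub>L f' p = id_blinfun"
    by (rule blinfun_eqI) (simp add: f'_apply[OF pU] l_def)
  then obtain U' V' F F' where U': "open U'" "U' \<subseteq> U" "p \<in> U'" and V': "open V'" "G p \<in> V'"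
    and hom: "homeomorphism U' V' G F"
    and dF: "\<And>y. y \<in> V' \<Longrightarrow> (F has_derivative F' y) (at y)"
    and F': "\<And>y. y \<in> V' \<Longrightarrow> F' y = inv (blinfun_apply (f' (F y)))"
    and bij: "\<And>y. y \<in> V' \<Longrightarrow> bij (blinfun_apply (f' (F y)))"
    using inverse_function_theorem[OF \<open>open U\<close> dG contf' pU] by metis
  obtain r where r: "r > 0" "ball (G p) r \<subseteq> V'" using V' openE by blast
  define N where "N = F ` ball (G p) r"
  have homN: "homeomorphism N (ball (G p) r) G F"
  proof (rule homeomorphism_of_subsets[OF hom _ r(2)])
    show "N \<subseteq> U'" unfolding N_def using r(2) homeomorphism_image2[OF hom] by blast
    have "G (F y) = y" if "y \<in> ball (G p) r" for y
      using homeomorphism_apply2[OF hom] r(2) that by blast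
    then show "G ` N = ball (G p) r" unfolding N_def by (force simp: image_image)
  qed
  have "N \<subseteq> U'" unfolding N_def using r(2) homeomorphism_image2[OF hom] by blast
  have Neq: "N = U' \<inter> G -` ball (G p) r"
  proof
    show "N \<subseteq> U' \<inter> G -` ball (G p) r"
      using \<open>N \<subseteq> U'\<close> homeomorphism_image1[OF homN] by blast
    show "U' \<inter> G -` ball (G p) r \<subseteq> N"
    proof
      fix q assume "q \<in> U' \<inter> G -` ball (G p) r"
      then have "q = F (G q)" "G q \<in> ball (G p) r" using homeomorphism_apply1[OF hom] by auto
      then show "q \<in> N" unfolding N_def by (rule image_eqI)
    qed
  qed
  have "open N" unfolding Neq
    using continuous_open_preimage[OF homeomorphism_cont1[OF hom] U'(1)] by auto
  have pN: "p \<in> N" using Neq U'(3) r(1) by simp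
  have NU: "N \<subseteq> U" using \<open>N \<subseteq> U'\<close> U' by blast
  define C where "C = 1 + 2 * B * norm \<nu>"
  have "level_chart h p N r G F \<nu> C"
  proof
    show "smooth_on h N" using smooth_on_subset[OF h \<open>open N\<close>] NU UV by blast
    show "p \<in> N" "r > 0" "homeomorphism N (ball (G p) r) G F" by fact+
    show "C > 0" unfolding C_def using B by (simp add: add_pos_nonneg)
    show "D h p (G q) = h q" for q
    proof -
      have "l (G q) = h q"
        unfolding G_def by (simp add: linear_add[OF lin] linear_cmul[OF lin] l\<nu>)
      then show ?thesis by (simp add: l_def)
    qed
    show tr: "D h q \<nu> > 0" if "q \<in> N" for q using NU that unfolding U_def by auto
    show "norm (level_field h \<nu> w q) \<le> C * norm w" if q: "q \<in> N" for q w
    proof -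
      have half: "D h q \<nu> > 1/2" and sB: "(\<Sum>b\<in>Basis. \<bar>D h q b\<bar>) < B" using NU q unfolding U_def by auto
      have "q \<in> V" using NU UV q by blast
      have "\<bar>D h q w\<bar> \<le> (\<Sum>b\<in>Basis. \<bar>(w \<bullet> b) *\<^sub>R D h q b\<bar>)"
        by (subst D_representation[OF h \<open>q \<in> V\<close>]) (rule sum_abs)
      also have "\<dots> \<le> (\<Sum>b\<in>Basis. norm w * \<bar>D h q b\<bar>)"
        by (intro sum_mono) (simp add: abs_mult mult_right_mono Basis_le_norm)
      also have "\<dots> \<le> norm w * B"
        unfolding sum_distrib_left[symmetric] using sB by (intro mult_left_mono) auto
      finally have 1: "\<bar>D h q w\<bar> \<le> norm w * B" .
      have "\<bar>D h q w / D h q \<nu>\<bar> = \<bar>D h q w\<bar> / D h q \<nu>" using half by simp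
      also have "\<dots> \<le> (norm w * B) / (1/2)" using 1 half by (intro frac_le) auto
      finally have "\<bar>D h q w / D h q \<nu>\<bar> * norm \<nu> \<le> (norm w * B) / (1/2) * norm \<nu>"
        by (intro mult_right_mono) auto
      moreover have "norm (level_field h \<nu> w q) \<le> norm w + \<bar>D h q w / D h q \<nu>\<bar> * norm \<nu>"
        unfolding level_field_def using norm_triangle_ineq4[of w "(D h q w / D h q \<nu>) *\<^sub>R \<nu>"] by simp
      ultimately show ?thesis unfolding C_def by (simp add: algebra_simps)
    qed
    show "((\<lambda>t. F (a + t *\<^sub>R w)) has_vector_derivative level_field h \<nu> w (F (a + t *\<^sub>R w))) (at t)"
      if w: "D h p w = 0" and at: "a + t *\<^sub>R w \<in> ball (G p) r" for a w t
    proof -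
      let ?y = "a + t *\<^sub>R w" let ?q = "F ?y" let ?v = "F' ?y w"
      have y: "?y \<in> V'" using at r by blast
      have q: "?q \<in> N" using at unfolding N_def by blast
      then have qU: "?q \<in> U" "?q \<in> V" using NU UV by blast+
      have "blinfun_apply (f' ?q) ?v = w" unfolding F'[OF y] using bij[OF y] by (simp add: bij_is_surj surj_f_inv_f)
      then have eq: "?v + (D h ?q ?v - l ?v) *\<^sub>R \<nu> = w" using f'_apply[OF qU(1)] by simp
      have "l ?v + (D h ?q ?v - l ?v) = l w"
        using arg_cong[OF eq, of l] by (simp add: linear_add[OF lin] linear_cmul[OF lin] l\<nu>)
      then have v0: "D h ?q ?v = 0" using w by (simp add: l_def)
      note lq = smooth_on_linear_D[OF h qU(2)]
      have "D h ?q ?v + (D h ?q ?v - l ?v) * D h ?q \<nu> = D h ?q w"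
        using arg_cong[OF eq, of "D h ?q"] by (simp add: linear_add[OF lq] linear_cmul[OF lq])
      then have "l ?v = - (D h ?q w / D h ?q \<nu>)" using v0 tr[OF q] by (simp add: field_simps)
      then have v: "?v = level_field h \<nu> w ?q" using eq v0 unfolding level_field_def
        by (simp add: algebra_simps)
      have "((\<lambda>t. a + t *\<^sub>R w) has_derivative (\<lambda>d. d *\<^sub>R w)) (at t)"
        by (auto intro!: derivative_eq_intros)
      from has_derivative_compose[OF this dF[OF y]]
      show ?thesis unfolding has_vector_derivative_def v[symmetric]
        using linear_cmul[OF has_derivative_linear[OF dF[OF y]]] by simp
    qed
  qed
  then show ?thesis using that NU UV by blast
qed

context level_chart
begin

lemma F_in: "a \<in> ball (G p) r \<Longrightarrow> F a \<in> N"
  using homeo unfolding homeomorphism_def by blast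

lemma G_in: "q \<in> N \<Longrightarrow> G q \<in> ball (G p) r"
  using homeo unfolding homeomorphism_def by blast

lemma FG: "q \<in> N \<Longrightarrow> F (G q) = q"
  using homeo unfolding homeomorphism_def by blast

lemma GF: "a \<in> ball (G p) r \<Longrightarrow> G (F a) = a"
  using homeo unfolding homeomorphism_def by blast

lemma h_F: "a \<in> ball (G p) r \<Longrightarrow> h (F a) = D h p a"
  using h_eq[OF F_in] GF by simp

lemma continuous_F: "continuous_on (ball (G p) r) F"
  using homeo unfolding homeomorphism_def by blast

lemma continuous_G: "continuous_on N G"
  using homeo unfolding homeomorphism_def by blast

lemma open_N: "open N" using smooth smooth_onD by blast

lemma linear_l: "linear (D h p)" using smooth_on_linear_D[OF smooth p_in] .

lemma D_level_field: "q \<in> N \<Longrightarrow> D h q (level_field h \<nu> w q) = 0"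
  unfolding level_field_def
  using transversal[of q] smooth_on_linear_D[OF smooth, of q] by (simp add: linear_diff linear_cmul)

lemma smooth_level_field: "smooth_on (level_field h \<nu> w) N"
proof -
  have "Ck_on k (\<lambda>q. w + (-1::real) *\<^sub>R ((D h q w * inverse (D h q \<nu>)) *\<^sub>R \<nu>)) N" for k
    using smooth_onD(2)[OF smooth_on_D[OF smooth]] transversal
    by (intro Ck_on_add Ck_on_bilinear[OF bounded_bilinear_scaleR] Ck_on_bilinear[OF bounded_bilinear_mult]
        Ck_on_const open_N Ck_on_inverse) (auto simp: less_imp_neq[symmetric])
  then show ?thesis unfolding smooth_on_def level_field_def using open_N by (simp add: divide_inverse)
qed

lemma segment_in_ball:
  assumes "a \<in> ball (G p) r" "b \<in> ball (G p) r" "t \<in> {0..1}"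
  shows "a + t *\<^sub>R (b - a) \<in> ball (G p) r"
proof -
  have "(1 - t) *\<^sub>R a + t *\<^sub>R b \<in> ball (G p) r"
    using assms convexD_alt[OF convex_ball] by auto
  then show ?thesis by (simp add: algebra_simps)
qed

text \<open>Points of equal height in the chart are joined inside their level set by the preimage of a
  segment.\<close>

lemma level_path:
  assumes a: "a \<in> ball (G p) r" and b: "b \<in> ball (G p) r" and ab: "D h p a = D h p b"
  defines "\<eta> \<equiv> \<lambda>t. F (a + t *\<^sub>R (b - a))"
  shows "valid_path \<eta>" "pathstart \<eta> = F a" "pathfinish \<eta> = F b"
    and "\<And>t. t \<in> {0..1} \<Longrightarrow> \<eta> t \<in> N \<and> h (\<eta> t) = D h p a"
    and "\<And>t. t \<in> {0..1} \<Longrightarrow> D h (\<eta> t) (vector_derivative \<eta> (at t)) = 0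
           \<and> norm (vector_derivative \<eta> (at t)) \<le> C * norm (b - a)"
proof -
  let ?w = "b - a"
  have w: "D h p ?w = 0" using ab by (simp add: linear_diff[OF linear_l])
  have inb: "a + t *\<^sub>R ?w \<in> ball (G p) r" if "t \<in> {0..1}" for t using segment_in_ball[OF a b that] .
  have d: "(\<eta> has_vector_derivative level_field h \<nu> ?w (\<eta> t)) (at t)" if "t \<in> {0..1}" for t
    unfolding \<eta>_def using F_deriv[OF w inb[OF that]] .
  show N: "\<eta> t \<in> N \<and> h (\<eta> t) = D h p a" if "t \<in> {0..1}" for t
    unfolding \<eta>_def using F_in[OF inb[OF that]] h_F[OF inb[OF that]] w
    by (simp add: linear_add[OF linear_l] linear_cmul[OF linear_l])
  have cont: "continuous_on {0..1} \<eta>"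
    using has_vector_derivative_continuous[OF d] by (simp add: continuous_at_imp_continuous_on)
  have "continuous_on {0..1} (\<lambda>t. level_field h \<nu> ?w (\<eta> t))"
    using continuous_on_compose2[OF smooth_on_continuous[OF smooth_level_field] cont] N by blast
  then have "\<eta> C1_differentiable_on {0..1}"
    unfolding C1_differentiable_on_def
    by (intro exI[of _ "\<lambda>t. level_field h \<nu> ?w (\<eta> t)"]) (simp add: d)
  then show "valid_path \<eta>"
    by (simp add: valid_path_def C1_differentiable_imp_piecewise)
  show "pathstart \<eta> = F a" "pathfinish \<eta> = F b"
    by (simp_all add: \<eta>_def pathstart_def pathfinish_def)
  show "D h (\<eta> t) (vector_derivative \<eta> (at t)) = 0 \<and> norm (vector_derivative \<eta> (at t)) \<le> C * norm (b - a)"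
    if t: "t \<in> {0..1}" for t
    using vector_derivative_at[OF d[OF t]] D_level_field field_bound N[OF t] by simp
qed

text \<open>Every vector in the kernel of \<open>dh\<^sub>p\<close> is the velocity of a smooth curve in the level set, namely
  of the preimage of a straight line.\<close>

lemma tangent_vector:
  assumes w: "D h p w = 0" and M: "{q \<in> N. h q = h p} \<subseteq> M"
  shows "w \<in> tangent_space M p"
proof -
  define \<gamma> where "\<gamma> = (\<lambda>t. F (G p + t *\<^sub>R w))"
  define e where "e = r / (norm w + 1)"
  have e: "e > 0" unfolding e_def using r_pos by (simp add: add_nonneg_pos)
  have inb: "G p + t *\<^sub>R w \<in> ball (G p) r" if "t \<in> {-e<..<e}" for t
  proof -
    have "norm (t *\<^sub>R w) \<le> \<bar>t\<bar> * (norm w + 1)" by (simp add: algebra_simps)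
    also have "\<dots> < e * (norm w + 1)" using that by (intro mult_strict_right_mono) (auto simp: add_nonneg_pos)
    also have "\<dots> = r" unfolding e_def by (simp add: add_nonneg_eq_0_iff)
    finally show ?thesis by (simp add: dist_norm)
  qed
  have d: "(\<gamma> has_vector_derivative level_field h \<nu> w (\<gamma> t)) (at t)" if "t \<in> {-e<..<e}" for t
    unfolding \<gamma>_def using F_deriv[OF w inb[OF that]] .
  have N: "\<gamma> t \<in> N" "h (\<gamma> t) = h p" if "t \<in> {-e<..<e}" for t
    unfolding \<gamma>_def using F_in[OF inb[OF that]] h_F[OF inb[OF that]] w h_eq[OF p_in]
    by (simp_all add: linear_add[OF linear_l] linear_cmul[OF linear_l])
  have "\<gamma> ` {-e<..<e} \<subseteq> N" using N(1) by blast
  then have "smooth_on \<gamma> {-e<..<e}"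
    using smooth_on_integral_curve[OF open_greaterThanLessThan smooth_level_field _ d] by blast
  moreover have "\<gamma> ` {-e<..<e} \<subseteq> M"
  proof
    fix x assume "x \<in> \<gamma> ` {-e<..<e}"
    then obtain t where "t \<in> {-e<..<e}" "x = \<gamma> t" by blast
    then show "x \<in> M" using N[of t] M by auto
  qed
  moreover have \<gamma>0: "\<gamma> 0 = p" unfolding \<gamma>_def using FG[OF p_in] by simp
  moreover have "(\<gamma> has_vector_derivative w) (at 0)"
    using d[of 0] e \<gamma>0 w by (simp add: level_field_def)
  ultimately show ?thesis unfolding tangent_space_def using e by blast
qed

end

lemma tangent_space_D_zero:
  fixes h :: "'a::euclidean_space \<Rightarrow> real"
  assumes h: "smooth_on h V" and M: "M \<subseteq> V" "\<And>q. q \<in> M \<Longrightarrow> h q = c" and v: "v \<in> tangent_space M p"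
  shows "D h p v = 0"
proof -
  obtain \<gamma> e where e: "e > 0" "\<gamma> ` {-e<..<e} \<subseteq> M" "\<gamma> 0 = p" "(\<gamma> has_vector_derivative v) (at 0)"
    using v unfolding tangent_space_def by blast
  have "0 \<in> {-e<..<e}" using e(1) by simp
  then have "\<gamma> 0 \<in> M" using e(2) by blast
  then have "p \<in> V" using M e(3) by blast
  have "((\<lambda>t. h (\<gamma> t)) has_derivative (\<lambda>t. D h p (t *\<^sub>R v))) (at 0)"
    using has_derivative_compose[OF e(4)[unfolded has_vector_derivative_def]]
      smooth_on_has_derivative[OF h \<open>p \<in> V\<close>] e(3) by blast
  moreover have "((\<lambda>t. h (\<gamma> t)) has_derivative (\<lambda>t. 0)) (at 0)"
    by (rule has_derivative_transform_within_open[of "\<lambda>t. c" _ _ _ "{-e<..<e}"])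
       (use e M in \<open>auto simp: image_subset_iff\<close>)
  ultimately have "(\<lambda>t. D h p (t *\<^sub>R v)) = (\<lambda>t. 0)" using has_derivative_unique by blast
  then have "D h p (1 *\<^sub>R v) = 0" by metis
  then show ?thesis by simp
qed

section \<open>Lengths of curves\<close>

lemma curve_length_le:
  assumes "K \<ge> 0"
    and "\<And>t. t \<in> {0..1} \<Longrightarrow> g (\<gamma> t) (vector_derivative \<gamma> (at t)) (vector_derivative \<gamma> (at t)) \<le> K\<^sup>2"
  shows "curve_length g \<gamma> \<le> ennreal K"
proof -
  have "curve_length g \<gamma> \<le> (\<integral>\<^sup>+t. ennreal K * indicator {0..1::real} t \<partial>lborel)"
    unfolding curve_length_def
  proof (intro nn_integral_mono)
    fix t :: real
    show "ennreal (sqrt (g (\<gamma> t) (vector_derivative \<gamma> (at t)) (vector_derivative \<gamma> (at t)))) * indicator {0..1} t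
        \<le> ennreal K * indicator {0..1} t"
    proof (cases "t \<in> {0..1}")
      case True
      then have "sqrt (g (\<gamma> t) (vector_derivative \<gamma> (at t)) (vector_derivative \<gamma> (at t))) \<le> sqrt (K\<^sup>2)"
        using assms(2) by (intro real_sqrt_le_mono) blast
      then show ?thesis using True assms(1) by (simp add: ennreal_leI)
    qed simp
  qed
  then show ?thesis by (simp add: nn_integral_cmult)
qed

text \<open>The derivative of \<open>\<phi>\<close> is continuous off a finite set, hence measurable, and the integral of its
  norm is at most the lower integral of \<open>F\<close>. If the latter is infinite nothing is claimed;
  otherwise the derivative is Lebesgue integrable, possibly unbounded, and the fundamental theorem
  of calculus for the Henstock-Kurzweil integral applies.\<close>

lemma norm_increment_le_nn_integral:
  fixes \<phi> :: "real \<Rightarrow> 'b::euclidean_space"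
  assumes ab: "a \<le> b" and cont: "continuous_on {a..b} \<phi>" and S: "finite S"
    and deriv: "\<And>t. t \<in> {a<..<b} - S \<Longrightarrow> (\<phi> has_vector_derivative \<phi>' t) (at t)"
    and cont': "continuous_on ({a<..<b} - S) \<phi>'"
    and le: "\<And>t. t \<in> {a<..<b} - S \<Longrightarrow> norm (\<phi>' t) \<le> F t"
  shows "ennreal (norm (\<phi> b - \<phi> a)) \<le> (\<integral>\<^sup>+t\<in>{a..b}. ennreal (F t) \<partial>lborel)"
proof (cases "(\<integral>\<^sup>+t\<in>{a..b}. ennreal (F t) \<partial>lborel) = \<infinity>")
  case False
  let ?E = "{a<..<b} - S"
  define f where "f = (\<lambda>t. indicator ?E t *\<^sub>R \<phi>' t)"
  have "?E \<in> sets borel" using S by (intro borel_open open_Diff open_greaterThanLessThan finite_imp_closed)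
  then have meas: "f \<in> borel_measurable lborel"
    unfolding f_def using borel_measurable_continuous_on_indicator[OF _ cont'] by simp
  have bound: "(\<integral>\<^sup>+t. ennreal (norm (f t)) \<partial>lborel) \<le> (\<integral>\<^sup>+t\<in>{a..b}. ennreal (F t) \<partial>lborel)"
    by (intro nn_integral_mono) (use le in \<open>auto simp: f_def indicator_def intro!: ennreal_leI\<close>)
  then have int: "integrable lborel f"
    using meas False by (intro integrableI_bounded) (auto simp: top.not_eq_extremum order_le_less_trans)
  have "(\<phi>' has_integral (\<phi> b - \<phi> a)) {a..b}"
    by (rule fundamental_theorem_of_calculus_interior_strong[OF S ab deriv cont])
  then have "(f has_integral (\<phi> b - \<phi> a)) {a..b}"
    by (rule has_integral_spike_finite[rotated -1, where S = "S \<union> {a,b}"])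
       (use S in \<open>auto simp: f_def indicator_def\<close>)
  then have "(f has_integral (\<phi> b - \<phi> a)) UNIV"
    by (rule has_integral_on_superset) (auto simp: f_def indicator_def)
  then have "\<phi> b - \<phi> a = integral\<^sup>L lborel f"
    using has_integral_integral_lborel[OF int] has_integral_unique by blast
  then show ?thesis using integral_norm_bound_ennreal[OF int] bound by simp
qed simp

text \<open>A map \<open>f\<close> that is Lipschitz infinitesimally along the part of a curve over \<open>[a, b]\<close> bounds its
  length from below. It is used with the identity and with \<open>f(x) = log |x|\<close>.\<close>

lemma curve_length_ge:
  fixes f :: "'a::euclidean_space \<Rightarrow> 'b::euclidean_space"
  assumes \<gamma>: "valid_path \<gamma>" and ab: "0 \<le> a" "a \<le> b" "b \<le> 1" and c: "c \<ge> 0"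
    and W: "\<gamma> ` {a..b} \<subseteq> W"
    and f: "\<And>x. x \<in> W \<Longrightarrow> (f has_derivative f' x) (at x)"
    and f': "continuous_on (W \<times> UNIV) (\<lambda>(x, v). f' x v)"
    and le: "\<And>t. t \<in> {a<..<b} \<Longrightarrow> \<gamma> differentiable (at t) \<Longrightarrow>
      c * norm (f' (\<gamma> t) (vector_derivative \<gamma> (at t)))
        \<le> sqrt (g (\<gamma> t) (vector_derivative \<gamma> (at t)) (vector_derivative \<gamma> (at t)))"
  shows "ennreal (c * norm (f (\<gamma> b) - f (\<gamma> a))) \<le> curve_length g \<gamma>"
proof -
  let ?g' = "\<lambda>t. vector_derivative \<gamma> (at t)"
  obtain S where S: "finite S" "\<gamma> C1_differentiable_on {0..1} - S" and cont: "continuous_on {0..1} \<gamma>"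
    using \<gamma> unfolding valid_path_def piecewise_C1_differentiable_on_def by blast
  have diff: "\<gamma> differentiable (at t)" if "t \<in> {0..1} - S" for t
    using S(2) that unfolding C1_differentiable_on_eq by blast
  have cont': "continuous_on ({0..1} - S) ?g'"
    using S(2) unfolding C1_differentiable_on_eq by blast
  have W': "\<gamma> t \<in> W" if "t \<in> {a..b}" for t using W that by blast
  have sub: "{a<..<b} - S \<subseteq> {0..1} - S" "{a..b} \<subseteq> {0..1}" using ab by auto
  have "ennreal (norm (c *\<^sub>R f (\<gamma> b) - c *\<^sub>R f (\<gamma> a)))
      \<le> (\<integral>\<^sup>+t\<in>{a..b}. ennreal (sqrt (g (\<gamma> t) (?g' t) (?g' t))) \<partial>lborel)"
  proof (rule norm_increment_le_nn_integral[OF ab(2) _ S(1), where \<phi>' = "\<lambda>t. c *\<^sub>R f' (\<gamma> t) (?g' t)"])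
    have "continuous_on W f"
      using f by (meson continuous_at_imp_continuous_on has_derivative_continuous)
    then show "continuous_on {a..b} (\<lambda>t. c *\<^sub>R f (\<gamma> t))"
      using continuous_on_compose2[OF _ continuous_on_subset[OF cont sub(2)] W]
      by (intro continuous_on_scaleR continuous_on_const) blast
    fix t assume t: "t \<in> {a<..<b} - S"
    then have d: "\<gamma> differentiable (at t)" using diff sub by blast
    then have "(\<gamma> has_derivative (\<lambda>s. s *\<^sub>R ?g' t)) (at t)"
      using vector_derivative_works has_vector_derivative_def by blast
    moreover have fd: "(f has_derivative f' (\<gamma> t)) (at (\<gamma> t))" using f W' t by auto
    ultimately have "((\<lambda>t. f (\<gamma> t)) has_derivative (\<lambda>s. f' (\<gamma> t) (s *\<^sub>R ?g' t))) (at t)"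
      using has_derivative_compose by blast
    then have "((\<lambda>t. f (\<gamma> t)) has_vector_derivative f' (\<gamma> t) (?g' t)) (at t)"
      unfolding has_vector_derivative_def linear_cmul[OF has_derivative_linear[OF fd]] .
    then show "((\<lambda>t. c *\<^sub>R f (\<gamma> t)) has_vector_derivative c *\<^sub>R f' (\<gamma> t) (?g' t)) (at t)"
      using bounded_linear.has_vector_derivative[OF bounded_linear_scaleR_right] by blast
    show "norm (c *\<^sub>R f' (\<gamma> t) (?g' t)) \<le> sqrt (g (\<gamma> t) (?g' t) (?g' t))"
      using le[OF _ d] t c by simp
  next
    have "continuous_on ({a<..<b} - S) (\<lambda>t. (\<gamma> t, ?g' t))"
      using ab by (intro continuous_on_Pair continuous_on_subset[OF cont] continuous_on_subset[OF cont' sub(1)])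
        auto
    then have "continuous_on ({a<..<b} - S) (\<lambda>t. case (\<gamma> t, ?g' t) of (x, v) \<Rightarrow> f' x v)"
      by (rule continuous_on_compose2[OF f']) (use W' in auto)
    then show "continuous_on ({a<..<b} - S) (\<lambda>t. c *\<^sub>R f' (\<gamma> t) (?g' t))"
      by (intro continuous_on_scaleR continuous_on_const) simp
  qed
  also have "\<dots> \<le> curve_length g \<gamma>"
    unfolding curve_length_def
    by (intro nn_integral_mono mult_left_mono) (use sub(2) in \<open>auto simp: indicator_def\<close>)
  finally show ?thesis using c by (simp flip: scaleR_diff_right)
qed

lemma riemannian_dist_le:
  assumes "valid_path \<gamma>" "path_image \<gamma> \<subseteq> H" "pathstart \<gamma> = x" "pathfinish \<gamma> = y"
  shows "riemannian_dist H g x y \<le> curve_length g \<gamma>"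
  unfolding riemannian_dist_def using assms by (intro Inf_lower) blast

lemma riemannian_dist_lessE:
  assumes "riemannian_dist H g x y < e"
  obtains \<gamma> where "valid_path \<gamma>" "path_image \<gamma> \<subseteq> H" "pathstart \<gamma> = x" "pathfinish \<gamma> = y"
    "curve_length g \<gamma> < e"
proof -
  obtain l where "l < e"
    "l \<in> {curve_length g \<gamma> | \<gamma>.
       valid_path \<gamma> \<and> path_image \<gamma> \<subseteq> H \<and> pathstart \<gamma> = x \<and> pathfinish \<gamma> = y}"
    using assms unfolding riemannian_dist_def Inf_less_iff by blast
  then show ?thesis using that by auto
qed

lemma norm_le_euclidean_curve_length:
  assumes "valid_path \<gamma>"
  shows "ennreal (norm (pathfinish \<gamma> - pathstart \<gamma>)) \<le> curve_length (\<lambda>p v w. v \<bullet> w) \<gamma>"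
proof -
  have "ennreal (1 * norm (\<gamma> 1 - \<gamma> 0)) \<le> curve_length (\<lambda>p v w. v \<bullet> w) \<gamma>"
    by (rule curve_length_ge[OF assms, where W = UNIV and f' = "\<lambda>x v. v"])
       (auto simp: norm_eq_sqrt_inner[symmetric] case_prod_beta intro: continuous_intros)
  then show ?thesis by (simp add: pathfinish_def pathstart_def)
qed

lemma norm_le_euclidean_riemannian_dist:
  "ennreal (norm (y - x)) \<le> riemannian_dist H (\<lambda>p v w. v \<bullet> w) x y"
  unfolding riemannian_dist_def
  by (rule Inf_greatest) (use norm_le_euclidean_curve_length in auto)

section \<open>The homogeneous function on the cone\<close>

locale cone_function =
  fixes H :: "'a::euclidean_space set" and k :: real and h :: "'a \<Rightarrow> real" and V :: "'a set"
  assumes k: "k > 1"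
    and hyper: "smooth_hypersurface H"
    and zero_notin: "0 \<notin> H"
    and closure_sub: "closure (cone_over H) - {0} \<subseteq> V"
    and h: "smooth_on h V"
    and hom: "homogeneous_on V k h"
    and H_eq: "H = {p \<in> cone_over H. h p = 1}"
begin

abbreviation "U \<equiv> cone_over H"

lemma open_V: "open V" using smooth_onD(1)[OF h] .

lemma isCont_h: "x \<in> V \<Longrightarrow> isCont h x"
  using smooth_on_has_derivative[OF h] has_derivative_continuous by blast

lemma coneI: "x \<in> H \<Longrightarrow> t > 0 \<Longrightarrow> t *\<^sub>R x \<in> U"
  unfolding cone_over_def by blast

lemma coneE:
  assumes "x \<in> U" obtains t y where "t > 0" "y \<in> H" "x = t *\<^sub>R y"
  using assms unfolding cone_over_def by blast

lemma cone_scale: "x \<in> U \<Longrightarrow> t > 0 \<Longrightarrow> t *\<^sub>R x \<in> U"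
  using coneE coneI by (metis mult_pos_pos scaleR_scaleR)

lemma H_sub_U: "H \<subseteq> U" using coneI[of _ 1] by auto

lemma h_H: "x \<in> H \<Longrightarrow> h x = 1" using H_eq by blast

lemma in_HI: "x \<in> U \<Longrightarrow> h x = 1 \<Longrightarrow> x \<in> H" using H_eq by blast

lemma zero_notin_U: "0 \<notin> U" using zero_notin unfolding cone_over_def by auto

lemma closure_in_V: "x \<in> closure U \<Longrightarrow> x \<noteq> 0 \<Longrightarrow> x \<in> V" using closure_sub by blast

lemma U_sub_V: "U \<subseteq> V"
  using closure_in_V closure_subset zero_notin_U by blast

lemma H_sub_V: "H \<subseteq> V" using H_sub_U U_sub_V by blast

lemma euler: "p \<in> V \<Longrightarrow> D h p p = k * h p"
  using hom D_real_representation[OF h, of p p] unfolding homogeneous_on_def by metis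

text \<open>The derivative of Euler's identity \<open>dh\<^sub>q(q) = k h(q)\<close>.\<close>

lemma hess_radial: "p \<in> V \<Longrightarrow> hess h p v p = (k - 1) * D h p v"
proof -
  assume p: "p \<in> V"
  have "((\<lambda>q. D h q q) has_derivative (\<lambda>v. hess h p v p + D h p v)) (at p)"
    using has_derivative_D_field[OF h p has_derivative_ident] .
  moreover have "((\<lambda>q. D h q q) has_derivative (\<lambda>v. k * D h p v)) (at p)"
    by (rule has_derivative_transform_within_open[OF _ open_V p, of "\<lambda>q. k * h q"])
       (use smooth_on_has_derivative[OF h p] euler in \<open>auto intro: has_derivative_mult_right\<close>)
  ultimately have "(\<lambda>v. hess h p v p + D h p v) = (\<lambda>v. k * D h p v)" using has_derivative_unique by blast
  then have "hess h p v p + D h p v = k * D h p v" by metis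
  then show ?thesis by (simp add: algebra_simps)
qed

text \<open>By Euler's identity \<open>s\<^bsup>-k\<^esup> h(s x)\<close> has derivative zero in \<open>s\<close>.\<close>

lemma h_scale:
  assumes x: "x \<in> U" and t: "t > 0"
  shows "h (t *\<^sub>R x) = t powr k * h x"
proof -
  let ?f = "\<lambda>s. h (s *\<^sub>R x) * s powr (-k)"
  have "(?f has_real_derivative 0) (at s)" if s: "s > 0" for s
  proof -
    have q: "s *\<^sub>R x \<in> V" using cone_scale[OF x s] U_sub_V by blast
    have lin: "linear (D h (s *\<^sub>R x))" using smooth_on_linear_D[OF h q] .
    have "((\<lambda>s. s *\<^sub>R x) has_derivative (\<lambda>d. d *\<^sub>R x)) (at s)" by (auto intro!: derivative_eq_intros)
    from has_derivative_compose[OF this smooth_on_has_derivative[OF h q]]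
    have d: "((\<lambda>s. h (s *\<^sub>R x)) has_real_derivative D h (s *\<^sub>R x) x) (at s)"
      unfolding has_field_derivative_def using linear_cmul[OF lin] by (simp add: mult.commute[of _ "D h _ x"])
    have e: "s * D h (s *\<^sub>R x) x = k * h (s *\<^sub>R x)"
      using euler[OF q] linear_cmul[OF lin, of s x] by simp
    have "(?f has_real_derivative D h (s *\<^sub>R x) x * s powr (-k) + h (s *\<^sub>R x) * (-k * s powr (-k - 1))) (at s)"
      using d s by (auto intro!: derivative_eq_intros)
    moreover have "D h (s *\<^sub>R x) x * s powr (-k) + h (s *\<^sub>R x) * (-k * s powr (-k - 1)) = 0"
    proof -
      have "s powr (-k) = s * s powr (-k - 1)" using s by (simp add: powr_diff)
      then have "D h (s *\<^sub>R x) x * s powr (-k) = (s * D h (s *\<^sub>R x) x) * s powr (-k - 1)" by simp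
      then show ?thesis unfolding e by simp
    qed
    ultimately show ?thesis by simp
  qed
  then have "?f constant_on {0<..}"
    by (intro has_field_derivative_0_imp_constant_on) auto
  then have "?f t = ?f 1" unfolding constant_on_def using t by (metis greaterThan_iff zero_less_one)
  then have "h (t *\<^sub>R x) * t powr (-k) = h x" by simp
  then have "h (t *\<^sub>R x) * (t powr (-k) * t powr k) = h x * t powr k" by (simp add: mult.assoc[symmetric])
  then show ?thesis using t by (simp add: powr_add[symmetric] mult.commute)
qed

lemma h_pos: "x \<in> U \<Longrightarrow> h x > 0"
  by (metis coneE h_H h_scale H_sub_U subsetD mult.right_neutral powr_gt_zero less_irrefl)

lemma h_nonneg: assumes "x \<in> closure U" "x \<noteq> 0" shows "h x \<ge> 0"
proof -
  obtain s where s: "\<And>n. s n \<in> U" "s \<longlonglongrightarrow> x" using assms(1) closure_sequential by blast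
  have "(\<lambda>n. h (s n)) \<longlonglongrightarrow> h x"
    using isCont_tendsto_compose[OF isCont_h s(2)] closure_in_V[OF assms] by blast
  then show ?thesis using LIMSEQ_le_const[of _ "h x" 0] h_pos[OF s(1)] less_imp_le by blast
qed

subsection \<open>The cone is open\<close>

text \<open>Write points near \<open>p\<close> as \<open>(1 + t) x\<close> with \<open>x \<in> H\<close>. In a slice chart the coordinate normal to
  the slice is free to serve as \<open>t\<close>, which gives the map \<open>\<Phi>\<close> between spaces of equal dimension.
  Its derivative is injective since the position vector is transversal to \<open>H\<close>: \<open>dh\<^sub>p(p) = k \<noteq> 0\<close>
  while \<open>dh\<^sub>p\<close> vanishes along the slice. Hence the image of \<open>\<Phi>\<close> is a neighbourhood of \<open>p\<close>.\<close>

lemma H_interior: assumes p: "p \<in> H" shows "p \<in> interior U"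
proof -
  from bspec[OF hyper[unfolded smooth_hypersurface_def] p]
  obtain W Q and \<phi> \<psi> :: "'a \<Rightarrow> 'a" where "\<exists>b\<in>Basis. p \<in> W \<and> smooth_on \<phi> W \<and> smooth_on \<psi> Q \<and>
      homeomorphism W Q \<phi> \<psi> \<and> \<phi> ` (H \<inter> W) = {y \<in> Q. y \<bullet> b = 0}"
    by (elim exE)
  then obtain b where b: "b \<in> Basis" and W: "p \<in> W"
    and \<phi>: "smooth_on \<phi> W" and \<psi>: "smooth_on \<psi> Q" and homeo: "homeomorphism W Q \<phi> \<psi>"
    and slice: "\<phi> ` (H \<inter> W) = {y \<in> Q. y \<bullet> b = 0}"
    by blast
  define y0 where "y0 = \<phi> p"
  define P where "P = (\<lambda>y. y - (y \<bullet> b) *\<^sub>R b)"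
  have linP: "bounded_linear P" unfolding P_def by (intro bounded_linear_intros)
  have y0: "y0 \<in> Q" "y0 \<bullet> b = 0" using slice p W unfolding y0_def by blast+
  have Py0: "P y0 = y0" using y0 by (simp add: P_def)
  have Pb: "P y \<bullet> b = 0" for y using b by (simp add: P_def inner_diff_left)
  have \<psi>y0: "\<psi> y0 = p" using homeomorphism_apply1[OF homeo W] by (simp add: y0_def)
  have Q: "open Q" using smooth_onD[OF \<psi>] by blast
  have \<psi>H: "\<psi> y \<in> H" if "y \<in> Q" "y \<bullet> b = 0" for y
  proof -
    have "y \<in> \<phi> ` (H \<inter> W)" unfolding slice using that by simp
    then obtain q where "q \<in> H" "q \<in> W" "y = \<phi> q" by blast
    then show ?thesis using homeomorphism_apply1[OF homeo, of q] by simp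
  qed
  define S where "S = {y. y \<bullet> b > -1} \<inter> P -` Q"
  define \<Phi> where "\<Phi> = (\<lambda>y. (1 + y \<bullet> b) *\<^sub>R \<psi> (P y))"
  have contP: "continuous_on UNIV P" using linear_continuous_on[OF linP] .
  have "open (P -` Q)" using open_vimage[OF Q contP] .
  then have "open S" unfolding S_def
    by (intro open_Int open_Collect_less) (auto intro!: continuous_intros)
  have y0S: "y0 \<in> S" unfolding S_def using y0 Py0 by simp
  have PS: "P ` S \<subseteq> Q" unfolding S_def by blast
  have "continuous_on S (\<lambda>y. \<psi> (P y))"
    by (rule continuous_on_compose2[OF smooth_on_continuous[OF \<psi>] continuous_on_subset[OF contP] PS]) simp
  then have cont: "continuous_on S \<Phi>" unfolding \<Phi>_def by (intro continuous_intros)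
  have sub: "\<Phi> ` S \<subseteq> U"
  proof
    fix x assume "x \<in> \<Phi> ` S"
    then obtain y where y: "y \<in> S" "x = (1 + y \<bullet> b) *\<^sub>R \<psi> (P y)" unfolding \<Phi>_def by blast
    have "\<psi> (P y) \<in> H" using \<psi>H[OF _ Pb] y(1) by (simp add: S_def)
    then show "x \<in> U" unfolding y(2) by (rule coneI) (use y(1) in \<open>simp add: S_def\<close>)
  qed
  define \<Phi>' where "\<Phi>' = (\<lambda>z. (z \<bullet> b) *\<^sub>R p + D \<psi> y0 (P z))"
  have d\<psi>P: "((\<lambda>y. \<psi> (P y)) has_derivative (\<lambda>z. D \<psi> y0 (P z))) (at y0)"
    by (rule has_derivative_compose[OF bounded_linear_imp_has_derivative[OF linP]])
       (simp add: Py0 smooth_on_has_derivative[OF \<psi> y0(1)])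
  have d\<Phi>: "(\<Phi> has_derivative \<Phi>') (at y0)"
  proof -
    have "((\<lambda>y. 1 + y \<bullet> b) has_derivative (\<lambda>z. z \<bullet> b)) (at y0)"
      by (auto intro!: derivative_eq_intros)
    from has_derivative_scaleR[OF this d\<psi>P] show ?thesis
      unfolding \<Phi>_def \<Phi>'_def by (simp add: y0(2) Py0 \<psi>y0 add.commute)
  qed
  have inj\<psi>: "z = 0" if "D \<psi> y0 z = 0" for z
  proof -
    have "((\<lambda>y. \<phi> (\<psi> y)) has_derivative (\<lambda>z. D \<phi> p (D \<psi> y0 z))) (at y0)"
      using has_derivative_compose[OF smooth_on_has_derivative[OF \<psi> y0(1)], of \<phi> "D \<phi> p"]
        smooth_on_has_derivative[OF \<phi> W] \<psi>y0 by simp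
    moreover have "((\<lambda>y. \<phi> (\<psi> y)) has_derivative (\<lambda>z. z)) (at y0)"
      by (rule has_derivative_transform_within_open[OF has_derivative_ident Q y0(1)])
         (use homeomorphism_apply2[OF homeo] in auto)
    ultimately have "(\<lambda>z. D \<phi> p (D \<psi> y0 z)) = (\<lambda>z. z)" using has_derivative_unique by blast
    then have "D \<phi> p (D \<psi> y0 z) = z" by metis
    then show ?thesis using that linear_0[OF smooth_on_linear_D[OF \<phi> W]] by simp
  qed
  have pV: "p \<in> V" using p H_sub_V by blast
  have Dh\<psi>: "D h p (D \<psi> y0 (P z)) = 0" for z
  proof -
    have "((\<lambda>y. h (\<psi> (P y))) has_derivative (\<lambda>z. D h p (D \<psi> y0 (P z)))) (at y0)"
      using has_derivative_compose[OF d\<psi>P, of h "D h p"] smooth_on_has_derivative[OF h pV] Py0 \<psi>y0 by simp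
    moreover have "((\<lambda>y. h (\<psi> (P y))) has_derivative (\<lambda>z. 0)) (at y0)"
      by (rule has_derivative_transform_within_open[OF has_derivative_const[of 1] \<open>open S\<close> y0S])
         (use \<psi>H Pb h_H in \<open>simp add: S_def\<close>)
    ultimately have "(\<lambda>z. D h p (D \<psi> y0 (P z))) = (\<lambda>z. 0)" using has_derivative_unique by blast
    then show ?thesis by metis
  qed
  have lin: "linear \<Phi>'" using has_derivative_linear[OF d\<Phi>] .
  have "z = 0" if "\<Phi>' z = 0" for z
  proof -
    note lh = smooth_on_linear_D[OF h pV]
    have "D h p (\<Phi>' z) = (z \<bullet> b) * k"
      unfolding \<Phi>'_def using euler[OF pV] h_H[OF p] by (simp add: linear_add[OF lh] linear_cmul[OF lh] Dh\<psi>)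
    then have zb: "z \<bullet> b = 0" using that linear_0[OF lh] k by simp
    then have "P z = z" by (simp add: P_def)
    then have "D \<psi> y0 z = 0" using that zb by (simp add: \<Phi>'_def)
    then show ?thesis by (rule inj\<psi>)
  qed
  then have "inj \<Phi>'" using linear_injective_0[OF lin] by blast
  then obtain g' where "linear g'" "\<forall>x. \<Phi>' (g' x) = x"
    using linear_injective_isomorphism[OF lin] by blast
  then have "bounded_linear g'" "\<Phi>' \<circ> g' = id"
    by (auto simp: linear_conv_bounded_linear)
  from sussmann_open_mapping[OF \<open>open S\<close> cont y0S d\<Phi> this subset_refl]
  have "\<Phi> y0 \<in> interior (\<Phi> ` S)" using y0S \<open>open S\<close> by (simp add: interior_open)
  moreover have "\<Phi> y0 = p" by (simp add: \<Phi>_def y0(2) Py0 \<psi>y0)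
  ultimately show ?thesis using interior_mono[OF sub] by auto
qed

lemma open_U: "open U"
proof -
  have "x \<in> interior U" if x: "x \<in> U" for x
  proof -
    obtain t y where ty: "t > 0" "y \<in> H" "x = t *\<^sub>R y" using coneE[OF x] .
    have "open ((*\<^sub>R) t ` interior U)" using ty(1) by (intro open_scaling) auto
    moreover have "(*\<^sub>R) t ` interior U \<subseteq> U" using cone_scale ty(1) interior_subset by blast
    moreover have "x \<in> (*\<^sub>R) t ` interior U" using ty H_interior by blast
    ultimately show ?thesis using interiorI by blast
  qed
  then have "interior U = U" using interior_subset by blast
  then show ?thesis using open_interior by metis
qed

lemma D_scale: assumes x: "x \<in> U" and t: "t > 0"
  shows "D h (t *\<^sub>R x) v = t powr (k - 1) * D h x v"
proof -
  have tx: "t *\<^sub>R x \<in> V" and xV: "x \<in> V" using cone_scale[OF x t] x U_sub_V by auto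
  have "((\<lambda>y. h (t *\<^sub>R y)) has_derivative (\<lambda>v. D h (t *\<^sub>R x) (t *\<^sub>R v))) (at x)"
    using has_derivative_compose[OF has_derivative_scaleR_right[OF has_derivative_ident]
        smooth_on_has_derivative[OF h tx]] .
  moreover have "((\<lambda>y. h (t *\<^sub>R y)) has_derivative (\<lambda>v. t powr k * D h x v)) (at x)"
    by (rule has_derivative_transform_within_open[OF _ open_U x, of "\<lambda>y. t powr k * h y"])
       (use smooth_on_has_derivative[OF h xV] h_scale t in \<open>auto intro: has_derivative_mult_right\<close>)
  ultimately have "(\<lambda>v. D h (t *\<^sub>R x) (t *\<^sub>R v)) = (\<lambda>v. t powr k * D h x v)"
    using has_derivative_unique by blast
  then have "D h (t *\<^sub>R x) (t *\<^sub>R v) = t powr k * D h x v" by metis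
  then have "t * D h (t *\<^sub>R x) v = t powr k * D h x v"
    by (simp add: linear_cmul[OF smooth_on_linear_D[OF h tx]])
  then show ?thesis using t by (simp add: powr_diff field_simps)
qed

lemma hess_scale: assumes x: "x \<in> U" and t: "t > 0"
  shows "hess h (t *\<^sub>R x) v w = t powr (k - 2) * hess h x v w"
proof -
  have tx: "t *\<^sub>R x \<in> V" and xV: "x \<in> V" using cone_scale[OF x t] x U_sub_V by auto
  note dw = smooth_on_D[OF h, of w]
  have "((\<lambda>y. D h (t *\<^sub>R y) w) has_derivative (\<lambda>v. hess h (t *\<^sub>R x) (t *\<^sub>R v) w)) (at x)"
    unfolding hess_def
    using has_derivative_compose[OF has_derivative_scaleR_right[OF has_derivative_ident]
        smooth_on_has_derivative[OF dw tx]] .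
  moreover have "((\<lambda>y. D h (t *\<^sub>R y) w) has_derivative (\<lambda>v. t powr (k - 1) * hess h x v w)) (at x)"
    unfolding hess_def
    by (rule has_derivative_transform_within_open[OF _ open_U x, of "\<lambda>y. t powr (k - 1) * D h y w"])
       (use smooth_on_has_derivative[OF dw xV] D_scale t in \<open>auto intro: has_derivative_mult_right\<close>)
  ultimately have "(\<lambda>v. hess h (t *\<^sub>R x) (t *\<^sub>R v) w) = (\<lambda>v. t powr (k - 1) * hess h x v w)"
    using has_derivative_unique by blast
  then have "hess h (t *\<^sub>R x) (t *\<^sub>R v) w = t powr (k - 1) * hess h x v w" by metis
  then have "t * hess h (t *\<^sub>R x) v w = t powr (k - 1) * hess h x v w"
    using linear_cmul[OF hess_linear_left[OF h tx]] by simp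
  moreover have "t powr (k - 1) = t * t powr (k - 2)" using t by (simp add: powr_diff field_simps power2_eq_square)
  ultimately show ?thesis using t by simp
qed

subsection \<open>Tangent spaces and the centroaffine metric\<close>

text \<open>Since the cone is open, near \<open>p\<close> the hypersurface is the whole level set \<open>h = 1\<close>.\<close>

lemma chart_at_H:
  assumes p: "p \<in> H" and W: "open W" "p \<in> W"
  obtains N r G F \<nu> C where "N \<subseteq> W" "level_chart h p N r G F \<nu> C" "{q \<in> N. h q = 1} \<subseteq> H"
proof -
  have pV: "p \<in> V" and pW: "p \<in> W \<inter> U" using p H_sub_V H_sub_U W(2) by blast+
  have "D h p p \<noteq> 0" using euler[OF pV] h_H[OF p] k by simp
  from level_chart_exists[OF h pV this open_Int[OF W(1) open_U] pW]
  obtain N r G F \<nu> C where N: "N \<subseteq> (W \<inter> U) \<inter> V" and chart: "level_chart h p N r G F \<nu> C"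
    by blast
  have sub: "{q \<in> N. h q = 1} \<subseteq> H" using N in_HI by blast
  show ?thesis by (rule that[OF _ chart sub]) (use N in blast)
qed

lemma tangent_space_H: assumes p: "p \<in> H" shows "tangent_space H p = {v. D h p v = 0}"
proof
  show "tangent_space H p \<subseteq> {v. D h p v = 0}"
    using tangent_space_D_zero[OF h H_sub_V h_H] by (intro subsetI CollectI)
  obtain N r G F \<nu> C where "N \<subseteq> UNIV" and chart: "level_chart h p N r G F \<nu> C"
    and sub: "{q \<in> N. h q = 1} \<subseteq> H"
    by (rule chart_at_H[OF p open_UNIV UNIV_I])
  show "{v. D h p v = 0} \<subseteq> tangent_space H p"
  proof
    fix w assume "w \<in> {v. D h p v = 0}"
    then show "w \<in> tangent_space H p"
      using level_chart.tangent_vector[OF chart, of w H] sub unfolding h_H[OF p] by blast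
  qed
qed

text \<open>Differentiate \<open>dh(Y) = 0\<close> along a curve in \<open>H\<close> with velocity \<open>v\<close>.\<close>

lemma gauss_formula:
  assumes p: "p \<in> H" and v: "v \<in> tangent_space H p" and W: "p \<in> W" and Y: "smooth_on Y W"
    and tan: "\<And>q. q \<in> H \<inter> W \<Longrightarrow> Y q \<in> tangent_space H q"
  shows "D h p (D Y p v) = - hess h p v (Y p)"
proof -
  have pV: "p \<in> V" using p H_sub_V by blast
  obtain \<gamma> e where e: "e > 0" "\<gamma> ` {-e<..<e} \<subseteq> H" "\<gamma> 0 = p" "(\<gamma> has_vector_derivative v) (at 0)"
    and \<gamma>: "smooth_on \<gamma> {-e<..<e}"
    using v unfolding tangent_space_def by blast
  have lin: "linear (D Y p)" using smooth_on_linear_D[OF Y W] .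
  let ?L = "\<lambda>v. hess h p v (Y p) + D h p (D Y p v)"
  have "((\<lambda>q. D h q (Y q)) has_derivative ?L) (at (\<gamma> 0))"
    using has_derivative_D_field[OF h pV smooth_on_has_derivative[OF Y W]] e(3) by simp
  from has_derivative_compose[OF e(4)[unfolded has_vector_derivative_def] this]
  have 1: "((\<lambda>t. D h (\<gamma> t) (Y (\<gamma> t))) has_derivative (\<lambda>t. ?L (t *\<^sub>R v))) (at 0)" .
  let ?I = "{-e<..<e} \<inter> \<gamma> -` W"
  have "open ?I"
    using continuous_open_preimage[OF smooth_on_continuous[OF \<gamma>] open_greaterThanLessThan smooth_onD(1)[OF Y]] .
  moreover have "0 \<in> ?I" using e W by simp
  moreover have "0 = D h (\<gamma> t) (Y (\<gamma> t))" if "t \<in> ?I" for t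
  proof -
    have "\<gamma> t \<in> H \<inter> W" using that e(2) by blast
    then show ?thesis using tan[of "\<gamma> t"] tangent_space_H[of "\<gamma> t"] by auto
  qed
  ultimately have "((\<lambda>t. D h (\<gamma> t) (Y (\<gamma> t))) has_derivative (\<lambda>t. 0)) (at 0)"
    by (rule has_derivative_transform_within_open[OF has_derivative_const[of 0]])
  from has_derivative_unique[OF 1 this] have "(\<lambda>t. ?L (t *\<^sub>R v)) = (\<lambda>t. 0)" .
  from fun_cong[OF this, of 1] show ?thesis by simp
qed

text \<open>Apply \<open>dh\<^sub>p\<close> to the Gauss formula: it kills the tangential part and sends the position vector
  to \<open>k\<close>.\<close>

lemma centroaffine_metric_eq:
  assumes p: "p \<in> H" and v: "D h p v = 0" and w: "D h p w = 0"
  shows "centroaffine_metric H p v w = - hess h p v w / k"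
  unfolding centroaffine_metric_def
proof (rule the_equality)
  have pV: "p \<in> V" using p H_sub_V by blast
  note lh = smooth_on_linear_D[OF h pV]
  have vT: "v \<in> tangent_space H p" using tangent_space_H[OF p] v by blast
  show ex: "\<forall>W Y. p \<in> W \<and> smooth_on Y W \<and> (\<forall>q\<in>H \<inter> W. Y q \<in> tangent_space H q) \<and> Y p = w \<longrightarrow>
      D Y p v - (- hess h p v w / k) *\<^sub>R p \<in> tangent_space H p"
  proof (intro allI impI, elim conjE)
    fix W Y assume *: "p \<in> W" "smooth_on Y W" "\<forall>q\<in>H \<inter> W. Y q \<in> tangent_space H q" "Y p = w"
    have "D h p (D Y p v) = - hess h p v w" using gauss_formula[OF p vT *(1,2)] * by blast
    then show "D Y p v - (- hess h p v w / k) *\<^sub>R p \<in> tangent_space H p"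
      unfolding tangent_space_H[OF p] using euler[OF pV] h_H[OF p] k
      by (simp add: linear_diff[OF lh] linear_add[OF lh] linear_cmul[OF lh])
  qed
  fix c assume c: "\<forall>W Y. p \<in> W \<and> smooth_on Y W \<and> (\<forall>q\<in>H \<inter> W. Y q \<in> tangent_space H q) \<and> Y p = w \<longrightarrow>
      D Y p v - c *\<^sub>R p \<in> tangent_space H p"
  (* One tangent field with value \<open>w\<close> at \<open>p\<close> determines \<open>c\<close>; correct the constant field \<open>w\<close> by a
     multiple of the position vector, using \<open>dh\<^sub>q(q) = k\<close> on \<open>H\<close>. *)
  define Y where "Y = (\<lambda>q. w + (- 1 / k * D h q w) *\<^sub>R q)"
  have "smooth_on Y V"
    unfolding smooth_on_def Y_def
    using open_V smooth_onD(2)[OF smooth_on_D[OF h]]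
    by (intro conjI allI Ck_on_add Ck_on_bilinear[OF bounded_bilinear_scaleR]
        Ck_on_bilinear[OF bounded_bilinear_mult] Ck_on_const Ck_on_linear[OF bounded_linear_ident])
  moreover have "Y q \<in> tangent_space H q" if "q \<in> H \<inter> V" for q
  proof -
    have "D h q q = k" using euler[of q] h_H[of q] that by simp
    then show ?thesis
      using that k smooth_on_linear_D[OF h, of q]
      by (simp add: tangent_space_H Y_def linear_diff linear_add linear_cmul)
  qed
  moreover have "Y p = w" by (simp add: Y_def w)
  ultimately have "D Y p v - c *\<^sub>R p \<in> tangent_space H p"
    "D Y p v - (- hess h p v w / k) *\<^sub>R p \<in> tangent_space H p"
    using c ex pV by blast+
  then have "c * D h p p = (- hess h p v w / k) * D h p p"
    unfolding tangent_space_H[OF p] by (simp add: linear_diff[OF lh] linear_add[OF lh] linear_cmul[OF lh])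
  then show "c = - hess h p v w / k" using euler[OF pV] h_H[OF p] k by (simp add: field_simps)
qed

end

locale complete_cone_function = cone_function +
  assumes complete: "euclidean_complete H"
begin

subsection \<open>The hypersurface is closed\<close>

text \<open>On the compact set of unit vectors in the closed cone \<open>h\<close> is bounded, say by \<open>M\<close>, and
  \<open>1 = h(x) = |x|\<^bsup>k\<^esup> h(x / |x|) \<le> |x|\<^bsup>k\<^esup> M\<close> for \<open>x \<in> H\<close>.\<close>

lemma H_away_from_zero: "\<exists>r>0. \<forall>x\<in>H. r \<le> norm x"
proof -
  let ?K = "closure U \<inter> sphere 0 1"
  have KV: "?K \<subseteq> V" using closure_in_V by force
  have "compact ?K" using compact_sphere by (simp add: closed_Int_compact)
  moreover have "continuous_on ?K h" using smooth_on_continuous[OF h] KV continuous_on_subset by blast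
  ultimately have "compact (h ` ?K)" by (rule compact_continuous_image[rotated])
  then obtain M where M: "M > 0" "\<And>u. u \<in> ?K \<Longrightarrow> norm (h u) \<le> M"
    using compact_imp_bounded bounded_pos by (metis imageI)
  define r where "r = (1 / M) powr (1 / k)"
  have "r \<le> norm x" if x: "x \<in> H" for x
  proof (rule ccontr)
    assume "\<not> r \<le> norm x"
    moreover have nx: "norm x > 0" using x zero_notin by auto
    ultimately have "norm x powr k < r powr k" using k by (intro powr_less_mono2) auto
    also have "r powr k = 1 / M" unfolding r_def using k M by (simp add: powr_powr)
    finally have lt: "norm x powr k * M < 1" using M by (simp add: field_simps)
    let ?u = "(1 / norm x) *\<^sub>R x"
    have uU: "?u \<in> U" using cone_scale x H_sub_U nx by auto
    have "h x = norm x powr k * h ?u" using h_scale[OF uU nx] nx by simp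
    moreover have "?u \<in> ?K" using uU closure_subset nx by auto
    ultimately have "1 \<le> norm x powr k * M" using M(2)[of ?u] h_H[OF x]
      by (smt (verit) mult_left_mono powr_ge_zero real_norm_def)
    then show False using lt by simp
  qed
  moreover have "r > 0" unfolding r_def using M by simp
  ultimately show ?thesis by blast
qed

text \<open>A limit point \<open>p\<close> of \<open>H\<close> lies on the smooth level set \<open>h = 1\<close>, in which \<open>H\<close> is open.
  The straightened segment from a nearby point of \<open>H\<close> to \<open>p\<close> cannot leave \<open>H\<close>: up to the first
  exit its points form a Cauchy sequence for the intrinsic distance, whose limit in \<open>H\<close> would be the
  exit point.\<close>

lemma closed_H: "closed H"
proof -
  have "p \<in> H" if p: "p \<in> closure H" for p
  proof -
    obtain r0 where r0: "r0 > 0" "\<And>x. x \<in> H \<Longrightarrow> r0 \<le> norm x" using H_away_from_zero by blast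
    obtain s where s: "\<And>n. s n \<in> H" "s \<longlonglongrightarrow> p" using p closure_sequential by blast
    have "r0 \<le> norm p" using LIMSEQ_le_const[OF tendsto_norm[OF s(2)]] r0(2)[OF s(1)] by blast
    then have p0: "p \<noteq> 0" using r0(1) by auto
    have "p \<in> closure U" using p closure_mono[OF H_sub_U] by blast
    then have pV: "p \<in> V" using closure_in_V p0 by blast
    have "(\<lambda>n. h (s n)) \<longlonglongrightarrow> h p" using isCont_tendsto_compose[OF isCont_h[OF pV] s(2)] .
    then have hp: "h p = 1" by (simp add: h_H[OF s(1)] LIMSEQ_const_iff)
    have "D h p p \<noteq> 0" using euler[OF pV] hp k by simp
    from level_chart_exists[OF h pV this open_UNIV UNIV_I]
    obtain N r G F \<nu> C where NV: "N \<subseteq> UNIV \<inter> V" and chart: "level_chart h p N r G F \<nu> C" .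
    interpret level_chart h p N r G F \<nu> C by (rule chart)
    obtain q where q: "q \<in> H" "q \<in> N"
      using p open_N p_in open_Int_closure_eq_empty[of N H] by blast
    define a where "a = G q"
    define b where "b = G p"
    have ab: "a \<in> ball (G p) r" "b \<in> ball (G p) r" using G_in[OF q(2)] G_in[OF p_in] by (simp_all add: a_def b_def)
    have lab: "D h p a = 1" "D h p b = 1" using h_eq[OF q(2)] h_H[OF q(1)] h_eq[OF p_in] hp by (simp_all add: a_def b_def)
    define \<eta> where "\<eta> = (\<lambda>t. F (a + t *\<^sub>R (b - a)))"
    have inb: "a + t *\<^sub>R (b - a) \<in> ball (G p) r" if "t \<in> {0..1}" for t
      using segment_in_ball[OF ab that] .
    have lt: "D h p (a + t *\<^sub>R (b - a)) = 1" for t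
      using lab by (simp add: linear_add[OF linear_l] linear_cmul[OF linear_l] linear_diff[OF linear_l])
    have \<eta>h: "h (\<eta> t) = 1" if "t \<in> {0..1}" for t
      unfolding \<eta>_def using h_F[OF inb[OF that]] lt by simp
    have \<eta>0: "\<eta> 0 = q" and \<eta>1: "\<eta> 1 = p" unfolding \<eta>_def a_def b_def using FG q(2) p_in by auto
    have cont: "continuous_on {0..1} \<eta>"
      unfolding \<eta>_def
      by (rule continuous_on_compose2[OF continuous_F]) (use inb in \<open>auto intro!: continuous_intros\<close>)
    define A where "A = {0..1} \<inter> \<eta> -` (- U)"
    have A_iff: "t \<in> A \<longleftrightarrow> \<eta> t \<notin> H" if "t \<in> {0..1}" for t
      using \<eta>h[OF that] that in_HI H_sub_U by (auto simp: A_def)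
    show "p \<in> H"
    proof (rule ccontr)
      assume "p \<notin> H"
      then have "1 \<in> A" using A_iff[of 1] \<eta>1 by simp
      moreover have "closed A" unfolding A_def
        using continuous_closed_preimage[OF cont closed_atLeastAtMost] open_U by (simp add: closed_Compl)
      moreover have bdd: "bdd_below A" unfolding A_def by (rule bdd_belowI[of _ 0]) auto
      ultimately have InfA: "Inf A \<in> A" using closed_contains_Inf by blast
      define T where "T = Inf A"
      have T: "T \<in> {0..1}" "\<eta> T \<notin> H" using InfA A_iff unfolding T_def A_def by auto
      have before: "\<eta> t \<in> H" if "0 \<le> t" "t < T" for t
        using A_iff[of t] cInf_lower[OF _ bdd, of t] that T(1) unfolding T_def by force
      (* parameters strictly before the first exit time \<open>T\<close>, increasing to it *)
      define \<tau> where "\<tau> = (\<lambda>n. T * (1 - inverse (real (Suc n))))"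
      have T0: "T > 0" using T \<eta>0 q(1) by (metis atLeastAtMost_iff less_eq_real_def)
      have \<tau>: "0 \<le> \<tau> n" "\<tau> n < T" for n
        unfolding \<tau>_def using T0 by (auto simp: field_simps)
      have \<tau>01: "\<tau> n \<in> {0..1}" for n using \<tau>[of n] T(1) by auto
      have \<tau>lim: "\<tau> \<longlonglongrightarrow> T"
        unfolding \<tau>_def using tendsto_mult[OF tendsto_const[of T]
          tendsto_diff[OF tendsto_const[of 1] LIMSEQ_inverse_real_of_nat]] by simp
      define \<sigma> where "\<sigma> = (\<lambda>n. \<eta> (\<tau> n))"
      have \<sigma>H: "range \<sigma> \<subseteq> H" unfolding \<sigma>_def using before \<tau> by blast
      define E where "E = C * norm (b - a)"
      have dist: "riemannian_dist H (\<lambda>p v w. v \<bullet> w) (\<sigma> i) (\<sigma> j) \<le> ennreal (E * \<bar>\<tau> j - \<tau> i\<bar>)" for i j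
      proof -
        let ?a = "a + \<tau> i *\<^sub>R (b - a)" and ?b = "a + \<tau> j *\<^sub>R (b - a)"
        let ?\<gamma> = "\<lambda>t. F (?a + t *\<^sub>R (?b - ?a))"
        note path = level_path[OF inb[OF \<tau>01] inb[OF \<tau>01], of i j]
        have lab': "D h p ?a = D h p ?b" using lt by simp
        have ba: "?b - ?a = (\<tau> j - \<tau> i) *\<^sub>R (b - a)" by (simp add: algebra_simps)
        have on: "?\<gamma> t \<in> H" if "t \<in> {0..1}" for t
        proof -
          let ?s = "(1 - t) * \<tau> i + t * \<tau> j"
          have "0 \<le> ?s" using that \<tau> by (intro add_nonneg_nonneg mult_nonneg_nonneg) auto
          moreover have "?s < T" using convex_bound_lt[OF \<tau>(2)[of i] \<tau>(2)[of j], of "1 - t" t] that by auto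
          ultimately have "F (a + ?s *\<^sub>R (b - a)) \<in> H" using before[of ?s] by (simp only: \<eta>_def)
          moreover have "?a + t *\<^sub>R (?b - ?a) = a + ?s *\<^sub>R (b - a)"
            unfolding ba by (simp add: algebra_simps)
          ultimately show ?thesis by (simp only:)
        qed
        have "riemannian_dist H (\<lambda>p v w. v \<bullet> w) (\<sigma> i) (\<sigma> j) \<le> curve_length (\<lambda>p v w. v \<bullet> w) ?\<gamma>"
          by (rule riemannian_dist_le)
             (use path(1-3)[OF lab'] on in \<open>auto simp: \<sigma>_def \<eta>_def path_image_def\<close>)
        also have "\<dots> \<le> ennreal (E * \<bar>\<tau> j - \<tau> i\<bar>)"
        proof (rule curve_length_le)
          show "0 \<le> E * \<bar>\<tau> j - \<tau> i\<bar>" unfolding E_def using C_pos by simp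
          fix t :: real assume "t \<in> {0..1}"
          then have "norm (vector_derivative ?\<gamma> (at t)) \<le> C * norm (?b - ?a)" using path(5)[OF lab'] by blast
          then have "norm (vector_derivative ?\<gamma> (at t)) \<le> E * \<bar>\<tau> j - \<tau> i\<bar>" unfolding ba E_def by (simp add: mult_ac)
          then have "(norm (vector_derivative ?\<gamma> (at t)))\<^sup>2 \<le> (E * \<bar>\<tau> j - \<tau> i\<bar>)\<^sup>2" by (intro power_mono) auto
          then show "vector_derivative ?\<gamma> (at t) \<bullet> vector_derivative ?\<gamma> (at t) \<le> (E * \<bar>\<tau> j - \<tau> i\<bar>)\<^sup>2"
            by (simp add: power2_norm_eq_inner)
        qed
        finally show ?thesis .
      qed
      have Epos: "E \<ge> 0" unfolding E_def using C_pos by simp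
      have "\<forall>e>0. \<exists>N. \<forall>i\<ge>N. \<forall>j\<ge>N. riemannian_dist H (\<lambda>p v w. v \<bullet> w) (\<sigma> i) (\<sigma> j) < e"
      proof (intro allI impI)
        fix e :: ennreal assume "e > 0"
        obtain d where d: "d > 0" "ennreal d \<le> e"
        proof (cases e)
          case (real x)
          then show ?thesis using that[of x] \<open>e > 0\<close> by simp
        qed (use that[of 1] in simp)
        have "Cauchy \<tau>" using \<tau>lim LIMSEQ_imp_Cauchy by blast
        then obtain M where M: "\<And>i j. i \<ge> M \<Longrightarrow> j \<ge> M \<Longrightarrow> dist (\<tau> i) (\<tau> j) < d / (E + 1)"
          unfolding Cauchy_def using d Epos by (metis add_nonneg_pos divide_pos_pos zero_less_one)
        have "riemannian_dist H (\<lambda>p v w. v \<bullet> w) (\<sigma> i) (\<sigma> j) < e" if "i \<ge> M" "j \<ge> M" for i j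
        proof -
          have "\<bar>\<tau> j - \<tau> i\<bar> < d / (E + 1)" using M[OF that] by (simp add: dist_real_def)
          then have "(E + 1) * \<bar>\<tau> j - \<tau> i\<bar> < d" using Epos by (simp add: field_simps)
          then have "E * \<bar>\<tau> j - \<tau> i\<bar> < d" by (simp add: algebra_simps)
          then have "ennreal (E * \<bar>\<tau> j - \<tau> i\<bar>) < ennreal d" using d by (intro ennreal_lessI) auto
          then show ?thesis using dist[of i j] d(2) by (meson le_less_trans less_le_trans)
        qed
        then show "\<exists>N. \<forall>i\<ge>N. \<forall>j\<ge>N. riemannian_dist H (\<lambda>p v w. v \<bullet> w) (\<sigma> i) (\<sigma> j) < e" by blast
      qed
      then obtain l where l: "l \<in> H" "(\<lambda>i. riemannian_dist H (\<lambda>p v w. v \<bullet> w) (\<sigma> i) l) \<longlonglongrightarrow> 0"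
        using complete \<sigma>H unfolding euclidean_complete_def riemannian_complete_def by meson
      have "(\<lambda>i. ennreal (norm (l - \<sigma> i))) \<longlonglongrightarrow> 0"
        by (rule tendsto_sandwich[OF always_eventually[OF allI] always_eventually[OF allI] tendsto_const l(2)])
           (rule zero_le, rule norm_le_euclidean_riemannian_dist)
      then have "(\<lambda>i. norm (l - \<sigma> i)) \<longlonglongrightarrow> 0"
        using tendsto_ennrealD[of "\<lambda>i. norm (l - \<sigma> i)" 0] by simp
      then have "(\<lambda>i. norm (\<sigma> i - l)) \<longlonglongrightarrow> 0" by (simp only: norm_minus_commute[of l])
      then have "\<sigma> \<longlonglongrightarrow> l" by (rule LIM_zero_cancel[OF tendsto_norm_zero_cancel])
      moreover have "\<sigma> \<longlonglongrightarrow> \<eta> T" unfolding \<sigma>_def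
        by (rule continuous_on_tendsto_compose[OF cont \<tau>lim T(1) always_eventually[OF allI[OF \<tau>01]]])
      ultimately have "l = \<eta> T" by (rule LIMSEQ_unique)
      then show False using l(1) T(2) by simp
    qed
  qed
  then show ?thesis using closure_subset_eq by blast
qed

text \<open>Rescaling to the level \<open>h = 1\<close> turns a sequence in the cone that converges to \<open>q\<close> into one in
  the closed set \<open>H\<close>.\<close>

lemma in_cone_of_pos:
  assumes q: "q \<in> closure U" "q \<noteq> 0" "h q > 0"
  shows "q \<in> U"
proof -
  obtain s where s: "\<And>n. s n \<in> U" "s \<longlonglongrightarrow> q" using q(1) closure_sequential by blast
  let ?c = "\<lambda>x. h x powr (- 1 / k)"
  have H: "?c (s n) *\<^sub>R s n \<in> H" for n
  proof (rule in_HI)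
    have pos: "h (s n) > 0" using h_pos s(1) .
    then show "?c (s n) *\<^sub>R s n \<in> U" using cone_scale s(1) by simp
    have "h (?c (s n) *\<^sub>R s n) = (?c (s n)) powr k * h (s n)" using h_scale[OF s(1)] pos by simp
    also have "(?c (s n)) powr k = h (s n) powr (- 1)" using k by (simp add: powr_powr)
    also have "\<dots> * h (s n) = 1" using pos by (simp add: powr_minus)
    finally show "h (?c (s n) *\<^sub>R s n) = 1" .
  qed
  have "(\<lambda>n. h (s n)) \<longlonglongrightarrow> h q"
    using isCont_tendsto_compose[OF isCont_h s(2)] closure_in_V q by blast
  then have "(\<lambda>n. ?c (s n) *\<^sub>R s n) \<longlonglongrightarrow> ?c q *\<^sub>R q"
    by (intro tendsto_scaleR tendsto_powr tendsto_const s(2)) (use q(3) in auto)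
  then have "?c q *\<^sub>R q \<in> H" by (rule closed_sequentially[OF closed_H H])
  then have "h q powr (1 / k) *\<^sub>R (?c q *\<^sub>R q) \<in> U" by (rule coneI) (use q(3) in simp)
  moreover have "h q powr (1 / k) * ?c q = 1"
  proof -
    have "h q powr (1 / k) * ?c q = h q powr (1 / k + - 1 / k)" by (rule powr_add[symmetric])
    also have "\<dots> = 1" using q(3) by simp
    finally show ?thesis .
  qed
  ultimately show ?thesis by (simp only: scaleR_scaleR scaleR_one)
qed

subsection \<open>The boundary of the cone\<close>

lemma frontier_iff:
  assumes "q \<noteq> 0"
  shows "q \<in> frontier U \<longleftrightarrow> q \<in> closure U \<and> h q = 0"
proof -
  have "q \<in> U \<longleftrightarrow> h q \<noteq> 0" if "q \<in> closure U"
    using in_cone_of_pos[OF that assms] h_nonneg[OF that assms] h_pos[of q] by linarith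
  then show ?thesis by (auto simp: frontier_def interior_open[OF open_U])
qed

text \<open>The point is that near \<open>p\<close> the boundary is the whole level set \<open>h = 0\<close>, so that all of the
  kernel of \<open>dh\<^sub>p\<close> consists of velocities of curves in the boundary. The side \<open>h > 0\<close> of the
  straightened ball is connected, and the cone is open and closed in it, so it fills this side;
  and every point with \<open>h = 0\<close> is a limit of points of this side.\<close>

lemma tangent_space_frontier:
  assumes p: "p \<in> frontier U - {0}" and reg: "D h p \<noteq> (\<lambda>v. 0)"
  shows "tangent_space (frontier U - {0}) p = {v. D h p v = 0}"
proof
  have sub: "frontier U - {0} \<subseteq> V" using closure_sub unfolding frontier_def by blast
  have zero: "h q = 0" if "q \<in> frontier U - {0}" for q using frontier_iff that by blast
  show "tangent_space (frontier U - {0}) p \<subseteq> {v. D h p v = 0}"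
    using tangent_space_D_zero[OF h sub zero] by (intro subsetI CollectI)
  have pV: "p \<in> V" using p sub by blast
  obtain v0 where v0: "D h p v0 \<noteq> 0" using reg by blast
  have W: "open (- {0::'a})" "p \<in> - {0}" using p by auto
  from level_chart_exists[OF h pV v0 W]
  obtain N r G F \<nu> C where NV: "N \<subseteq> - {0} \<inter> V" and chart: "level_chart h p N r G F \<nu> C" .
  interpret level_chart h p N r G F \<nu> C by (rule chart)
  let ?B = "ball (G p) r \<inter> {a. D h p a > 0}"
  have N0: "q \<noteq> 0" if "q \<in> N" for q using NV that by blast
  have hF: "h (F a) > 0" "F a \<in> N" if "a \<in> ?B" for a using h_F[of a] F_in[of a] that by auto
  have conv: "convex {a. D h p a > 0}"
    using convex_linear_vimage[OF linear_l, of "{0<..}"] by (simp add: vimage_def)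
  have conn: "connected (F ` ?B)"
    using continuous_on_subset[OF continuous_F]
    by (intro connected_continuous_image convex_connected convex_Int convex_ball conv) blast
  have cover: "F ` ?B \<subseteq> U \<union> - closure U" using in_cone_of_pos hF N0 by blast
  have disj: "U \<inter> - closure U \<inter> F ` ?B = {}" using closure_subset by blast
  have "p \<in> closure U" using p by (simp add: frontier_def)
  then obtain q where q: "q \<in> U" "q \<in> N"
    using open_N p_in open_Int_closure_eq_empty[of N U] by blast
  have "q \<in> F ` ?B"
  proof (rule image_eqI)
    show "q = F (G q)" using FG q(2) by simp
    show "G q \<in> ?B" using G_in[OF q(2)] h_eq[OF q(2)] h_pos[OF q(1)] by simp
  qed
  then have FB: "F ` ?B \<subseteq> closure U"
    using connectedD[OF conn open_U open_Compl[OF closed_closure] disj cover] q(1) by blast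
  have "{q \<in> N. h q = h p} \<subseteq> frontier U - {0}"
  proof (intro subsetI, elim CollectE conjE)
    fix q assume qN: "q \<in> N" and hq: "h q = h p"
    have q0: "q \<noteq> 0" using N0 qN .
    have "q \<in> closure U"
    proof (rule ccontr)
      assume nq: "q \<notin> closure U"
      let ?O = "ball (G p) r \<inter> F -` (- closure U)"
      have "open ?O" by (rule continuous_open_preimage[OF continuous_F open_ball open_Compl[OF closed_closure]])
      moreover have "G q \<in> ?O" using G_in[OF qN] FG[OF qN] nq by simp
      ultimately obtain e where e: "e > 0" "ball (G q) e \<subseteq> ?O" using openE by blast
      define t where "t = e / (2 * (norm \<nu> + 1))"
      have t: "t > 0" unfolding t_def using e(1) by (simp add: add_nonneg_pos)
      have "t * norm \<nu> \<le> t * (norm \<nu> + 1)" using t by simp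
      also have "\<dots> = e / 2"
      proof -
        have "norm \<nu> + 1 > 0" by (simp add: add_nonneg_pos)
        then show ?thesis by (simp add: t_def del: distrib_left_numeral)
      qed
      also have "\<dots> < e" using e(1) by simp
      finally have "G q + t *\<^sub>R \<nu> \<in> ball (G q) e" using t by (simp add: dist_norm)
      then have O: "G q + t *\<^sub>R \<nu> \<in> ?O" using e(2) by blast
      have "D h p (G q + t *\<^sub>R \<nu>) = t * D h p \<nu>"
        using h_eq[OF qN] hq zero[OF p] by (simp add: linear_add[OF linear_l] linear_cmul[OF linear_l])
      then have "G q + t *\<^sub>R \<nu> \<in> ?B" using O t transversal[OF p_in] by simp
      then show False using FB O by blast
    qed
    then show "q \<in> frontier U - {0}" using frontier_iff[OF q0] hq zero[OF p] q0 by simp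
  qed
  then show "{v. D h p v = 0} \<subseteq> tangent_space (frontier U - {0}) p"
    using tangent_vector by blast
qed

end

section \<open>Completeness\<close>

locale regular_cone_function = complete_cone_function +
  assumes hyperbolic: "hyperbolic H"
    and regular: "\<And>p. p \<in> frontier U - {0} \<Longrightarrow> D h p \<noteq> (\<lambda>v. 0)"
    and boundary_nonneg: "\<And>p v. p \<in> frontier U - {0} \<Longrightarrow>
      v \<in> tangent_space (frontier U - {0}) p \<Longrightarrow> - hess h p v v \<ge> 0"
    and boundary_dim: "\<And>p. p \<in> frontier U - {0} \<Longrightarrow>
      dim {v \<in> tangent_space (frontier U - {0}) p.
        \<forall>w\<in>tangent_space (frontier U - {0}) p. - hess h p v w = 0} = 1"
begin

lemma hess_add_square:
  assumes "p \<in> V"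
  shows "hess h p (v + w) (v + w) = hess h p v v + 2 * hess h p v w + hess h p w w"
proof -
  have left: "hess h p (v + w) u = hess h p v u + hess h p w u" for u
    by (rule linear_add[OF hess_linear_left[OF h assms]])
  have right: "hess h p u (v + w) = hess h p u v + hess h p u w" for u
    by (rule linear_add[OF hess_linear_right[OF h assms]])
  show ?thesis unfolding right left hess_commute[OF h assms, of w v] by simp
qed

lemma hess_scaleR:
  assumes "p \<in> V"
  shows "hess h p (a *\<^sub>R v) w = a * hess h p v w" "hess h p v (a *\<^sub>R w) = a * hess h p v w"
  by (rule linear_cmul[OF hess_linear_left[OF h assms], unfolded real_scaleR_def],
      rule linear_cmul[OF hess_linear_right[OF h assms], unfolded real_scaleR_def])

text \<open>The form \<open>-\<nabla>\<^sup>2h\<close> is semidefinite on the kernel of \<open>dh\<^sub>p\<close>, so a null vector \<open>w\<close> lies in its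
  radical. The position vector \<open>p\<close> is always in the radical, and the radical is a line, so \<open>w\<close>
  cannot be orthogonal to \<open>p\<close>.\<close>

lemma boundary_hess_neg:
  assumes p: "p \<in> frontier U" "p \<noteq> 0" and w: "D h p w = 0" "w \<bullet> p = 0" "w \<noteq> 0"
  shows "hess h p w w < 0"
proof (rule ccontr)
  assume neg: "\<not> hess h p w w < 0"
  let ?T = "tangent_space (frontier U - {0}) p"
  let ?K = "{v \<in> ?T. \<forall>u\<in>?T. - hess h p v u = 0}"
  have p': "p \<in> frontier U - {0}" using p by blast
  have T: "?T = {v. D h p v = 0}" using tangent_space_frontier[OF p' regular[OF p']] .
  have hp: "h p = 0" "p \<in> V" using frontier_iff[OF p(2)] p closure_in_V by blast+
  note lh = smooth_on_linear_D[OF h hp(2)]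
  have nonpos: "hess h p u u \<le> 0" if "D h p u = 0" for u
    using boundary_nonneg[OF p', of u] that unfolding T by simp
  have hw: "hess h p w w = 0" using neg nonpos[OF w(1)] by simp
  have "hess h p w u = 0" if u: "D h p u = 0" for u
  proof -
    have line: "2 * s * hess h p w u + hess h p u u \<le> 0" for s
    proof -
      have "D h p (s *\<^sub>R w + u) = 0" using w(1) u by (simp add: linear_add[OF lh] linear_cmul[OF lh])
      from nonpos[OF this] show ?thesis
        unfolding hess_add_square[OF hp(2)] by (simp add: hess_scaleR[OF hp(2)] hw)
    qed
    show ?thesis
    proof (rule ccontr)
      assume ne: "hess h p w u \<noteq> 0"
      (* a value of \<open>s\<close> for which the affine function in \<open>line\<close> would equal 1 *)
      have "2 * ((1 - hess h p u u) / (2 * hess h p w u)) * hess h p w u + hess h p u u = 1"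
        using ne by (simp add: field_simps)
      then show False using line[of "(1 - hess h p u u) / (2 * hess h p w u)"] by linarith
    qed
  qed
  then have wK: "w \<in> ?K" using w(1) unfolding T by simp
  have "hess h p p u = 0" if "D h p u = 0" for u
    using hess_radial[OF hp(2), of u] hess_commute[OF h hp(2), of p u] that by simp
  then have pK: "p \<in> ?K" using euler[OF hp(2)] hp(1) unfolding T by simp
  have "independent {p, w}"
    using w p(2) by (intro pairwise_orthogonal_independent)
      (auto simp: pairwise_def orthogonal_def inner_commute)
  then have "card {p, w} \<le> dim ?K" using wK pK by (intro independent_card_le_dim) auto
  moreover have "p \<noteq> w" using w p(2) by auto
  ultimately show False using boundary_dim[OF p'] by simp
qed

text \<open>Only pairs of orthogonal unit vectors \<open>(u, z)\<close> with \<open>\<nabla>\<^sup>2h\<^sub>u(z, z) \<ge> 0\<close> matter, since the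
  bound is trivial where the Hessian is negative. They form a compact set \<open>Z\<close>, on which \<open>h(u) + dh\<^sub>u(z)\<^sup>2\<close> is positive because the two terms vanish together
  only at the boundary in a direction excluded by \<open>boundary_hess_neg\<close>. Let \<open>\<epsilon>\<close> be a positive
  lower bound; where \<open>h < \<epsilon> / 2\<close> the second term is at least \<open>\<epsilon> / 2\<close>.\<close>

lemma hess_bound_near_boundary:
  "\<exists>\<delta>>0. \<exists>C\<ge>0. \<forall>u\<in>closure U. \<forall>w. norm u = 1 \<and> h u < \<delta> \<and> w \<bullet> u = 0 \<longrightarrow> hess h u w w \<le> C * (D h u w)\<^sup>2"
proof -
  define K where "K = (closure U \<inter> sphere 0 1) \<times> sphere (0::'a) 1"
  have compK: "compact K" unfolding K_def by (intro compact_Times closed_Int_compact) auto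
  have KV: "fst ` K \<subseteq> V" using closure_in_V by (force simp: K_def)
  have c1: "continuous_on K (\<lambda>x. hess h (fst x) (snd x) (snd x))"
    by (rule continuous_on_hess[OF h _ KV]) (intro continuous_intros)+
  have c2: "continuous_on K (\<lambda>x. D h (fst x) (snd x))"
    by (rule continuous_on_D_pair[OF h _ KV]) (intro continuous_intros)+
  have c3: "continuous_on K (\<lambda>x. h (fst x))"
    by (rule continuous_on_compose2[OF smooth_on_continuous[OF h] _ KV]) (intro continuous_intros)
  define Z where "Z = (K \<inter> (\<lambda>x. hess h (fst x) (snd x) (snd x)) -` {0..}) \<inter> (K \<inter> (\<lambda>x. snd x \<bullet> fst x) -` {0})"
  have "continuous_on K (\<lambda>x. snd x \<bullet> fst x)" by (intro continuous_intros)
  then have "closed Z" unfolding Z_def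
    by (intro closed_Int continuous_closed_preimage[OF c1] continuous_closed_preimage[of K] compact_imp_closed[OF compK])
      auto
  then have compZ: "compact Z"
    using compact_Int_closed[OF compK, of Z] by (simp add: Z_def Int_assoc Int_left_absorb)
  have ZK: "Z \<subseteq> K" unfolding Z_def by blast
  let ?m = "\<lambda>x. h (fst x) + (D h (fst x) (snd x))\<^sup>2"
  have pos: "?m x > 0" if x: "x \<in> Z" for x
  proof -
    obtain u z where uz: "x = (u, z)" by fastforce
    have *: "u \<in> closure U" "u \<noteq> 0" "z \<noteq> 0" "hess h u z z \<ge> 0" "z \<bullet> u = 0"
      using x unfolding uz Z_def K_def by auto
    have "h u \<ge> 0" using h_nonneg *(1,2) .
    moreover have "\<not> (h u = 0 \<and> D h u z = 0)"
      using boundary_hess_neg[of u z] frontier_iff[of u] * by auto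
    ultimately show ?thesis unfolding uz
      by (simp add: add_pos_nonneg less_le) (auto simp: add_nonneg_eq_0_iff)
  qed
  obtain \<epsilon> where \<epsilon>: "\<epsilon> > 0" "\<And>x. x \<in> Z \<Longrightarrow> \<epsilon> \<le> ?m x"
  proof (cases "Z = {}")
    case True
    then show ?thesis using that[of 1] by simp
  next
    case False
    have "continuous_on Z ?m"
      using continuous_on_subset[OF c2 ZK] continuous_on_subset[OF c3 ZK] by (intro continuous_intros)
    then obtain x where "x \<in> Z" "\<forall>y\<in>Z. ?m x \<le> ?m y"
      using continuous_attains_inf[OF compZ False] by blast
    then show ?thesis using that[of "?m x"] pos by blast
  qed
  have "bounded ((\<lambda>x. hess h (fst x) (snd x) (snd x)) ` K)"
    using compact_continuous_image[OF c1 compK] compact_imp_bounded by blast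
  then obtain M where M: "M > 0" "\<forall>y\<in>(\<lambda>x. hess h (fst x) (snd x) (snd x)) ` K. norm y \<le> M"
    unfolding bounded_pos by blast
  define C where "C = 2 * M / \<epsilon>"
  have "hess h u w w \<le> C * (D h u w)\<^sup>2"
    if u: "u \<in> closure U" and *: "norm u = 1" "h u < \<epsilon> / 2" "w \<bullet> u = 0" for u w
  proof (cases "w = 0 \<or> hess h u w w < 0")
    case True
    have uV: "u \<in> V" by (rule closure_in_V[OF u]) (use *(1) in auto)
    have "hess h u w w \<le> 0" using True linear_0[OF hess_linear_left[OF h uV]] by auto
    also have "0 \<le> C * (D h u w)\<^sup>2" unfolding C_def using M(1) \<epsilon>(1) by simp
    finally show ?thesis .
  next
    case False
    have uV: "u \<in> V" by (rule closure_in_V[OF u]) (use *(1) in auto)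
    define z where "z = (1 / norm w) *\<^sub>R w"
    have w: "w = norm w *\<^sub>R z" using False by (simp add: z_def)
    have nz: "norm z = 1" "z \<bullet> u = 0" using False *(3) by (auto simp: z_def)
    have hw: "hess h u w w = (norm w)\<^sup>2 * hess h u z z"
      by (subst (1 2) w) (simp add: hess_scaleR[OF uV] power2_eq_square)
    have Dw: "D h u w = norm w * D h u z"
      by (subst w) (simp add: linear_cmul[OF smooth_on_linear_D[OF h uV]])
    have "hess h u z z \<ge> 0" using False hw by (auto simp: not_less zero_le_mult_iff)
    then have uz: "(u, z) \<in> Z" using u * nz by (simp add: Z_def K_def)
    then have "\<epsilon> / 2 \<le> (D h u z)\<^sup>2" using \<epsilon>(2)[OF uz] *(2) by simp
    then have "M \<le> C * (D h u z)\<^sup>2" unfolding C_def using M(1) \<epsilon>(1) by (simp add: field_simps)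
    moreover have "hess h u z z \<le> M"
    proof -
      have "hess h u z z \<in> (\<lambda>x. hess h (fst x) (snd x) (snd x)) ` K"
        by (rule image_eqI[of _ _ "(u, z)"]) (use uz ZK in auto)
      then show ?thesis using M(2) by fastforce
    qed
    ultimately have "(norm w)\<^sup>2 * hess h u z z \<le> (norm w)\<^sup>2 * (C * (D h u z)\<^sup>2)"
      by (intro mult_left_mono) auto
    then show ?thesis unfolding hw Dw by (simp add: power_mult_distrib mult_ac)
  qed
  moreover have "C \<ge> 0" unfolding C_def using M(1) \<epsilon>(1) by simp
  ultimately show ?thesis using \<epsilon>(1) half_gt_zero by blast
qed

text \<open>By \<open>centroaffine_metric_eq\<close> this is the quadratic form of the centroaffine metric on vectors
  tangent to \<open>H\<close>.\<close>

abbreviation (input) hess_metric :: "'a \<Rightarrow> 'a \<Rightarrow> real"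
  where "hess_metric x v \<equiv> - hess h x v v / k"

text \<open>The decisive estimate: far out on \<open>H\<close> the metric dominates a multiple of the square of
  \<open>d log |x|\<close>. Write \<open>x = r u\<close> with \<open>|u| = 1\<close> and \<open>v = w + a u\<close> with \<open>w\<close> orthogonal to \<open>u\<close>. Then
  \<open>-\<nabla>\<^sup>2h\<^sub>u(v, v) = -\<nabla>\<^sup>2h\<^sub>u(w, w) + a\<^sup>2 k (k - 1) h(u)\<close> and tangency means
  \<open>dh\<^sub>u(w) = -a k h(u)\<close>. So the first term is bounded below by \<open>-C a\<^sup>2 k\<^sup>2 h(u)\<^sup>2\<close>, which for small
  \<open>h(u) = r\<^bsup>-k\<^esup>\<close> is absorbed by half of the second; here \<open>k > 1\<close> enters. Scaling back from \<open>u\<close> to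
  \<open>x\<close> multiplies the Hessian by \<open>r\<^bsup>k-2\<^esup>\<close>.\<close>

lemma metric_ge_radial:
  "\<exists>R>0. \<forall>x\<in>H. \<forall>v. R < norm x \<and> D h x v = 0 \<longrightarrow>
     (k - 1) / 2 * ((v \<bullet> x) / (norm x)\<^sup>2)\<^sup>2 \<le> hess_metric x v"
proof -
  obtain \<delta> C where \<delta>: "\<delta> > 0" "C \<ge> 0" and bound:
    "\<And>u w. u \<in> closure U \<Longrightarrow> norm u = 1 \<Longrightarrow> h u < \<delta> \<Longrightarrow> w \<bullet> u = 0 \<Longrightarrow> hess h u w w \<le> C * (D h u w)\<^sup>2"
    using hess_bound_near_boundary by blast
  define \<epsilon> where "\<epsilon> = min \<delta> ((k - 1) / (2 * (C * k + 1)))"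
  have Ck: "C * k + 1 > 0" using \<delta>(2) k by (simp add: add_nonneg_pos)
  have \<epsilon>: "\<epsilon> > 0" "\<epsilon> \<le> \<delta>" unfolding \<epsilon>_def using \<delta> k Ck by auto
  have \<epsilon>2: "(C * k + 1) * \<epsilon> \<le> (k - 1) / 2"
  proof -
    have "(C * k + 1) * \<epsilon> \<le> (C * k + 1) * ((k - 1) / (2 * (C * k + 1)))"
      unfolding \<epsilon>_def using Ck by (intro mult_left_mono) auto
    also have "\<dots> = (k - 1) / 2" using Ck by (simp add: field_simps)
    finally show ?thesis .
  qed
  (* \<open>|x| > R\<close> says exactly that \<open>h(x / |x|) < \<epsilon>\<close> *)
  define R where "R = \<epsilon> powr (- 1 / k)"
  have "(k - 1) / 2 * ((v \<bullet> x) / (norm x)\<^sup>2)\<^sup>2 \<le> hess_metric x v"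
    if x: "x \<in> H" and R: "R < norm x" and v: "D h x v = 0" for x v
  proof -
    define r where "r = norm x"
    define u where "u = (1 / r) *\<^sub>R x"
    have r: "r > 0" unfolding r_def using x zero_notin by auto
    have xu: "x = r *\<^sub>R u" unfolding u_def using r by simp
    have uU: "u \<in> U" unfolding u_def using cone_scale x H_sub_U r by auto
    have uV: "u \<in> V" using uU U_sub_V by blast
    have nu: "norm u = 1" unfolding u_def using r by (simp add: r_def)
    then have uu: "u \<bullet> u = 1" by (simp add: dot_square_norm)
    note lh = smooth_on_linear_D[OF h uV]
    have "r powr k * h u = 1" using h_scale[OF uU r] h_H[OF x] xu by simp
    then have hu: "h u = r powr (- k)" using r by (simp add: powr_minus field_simps)
    have "r powr (- k) < R powr (- k)"
      using R k \<epsilon>(1) unfolding r_def[symmetric] R_def by (intro powr_less_mono2_neg) auto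
    also have "R powr (- k) = \<epsilon>" unfolding R_def using k \<epsilon>(1) by (simp add: powr_powr)
    finally have hue: "h u < \<epsilon>" using hu by simp
    have hu0: "h u > 0" using h_pos[OF uU] .
    define a where "a = v \<bullet> u"
    define w where "w = v - a *\<^sub>R u"
    have vw: "v = w + a *\<^sub>R u" by (simp add: w_def)
    have wu: "w \<bullet> u = 0" by (simp add: w_def a_def inner_diff_left uu)
    have "D h u v = 0" using v D_scale[OF uU r, of v] r unfolding xu[symmetric] by simp
    then have Dw: "D h u w = - (a * k * h u)"
      unfolding vw by (simp add: linear_add[OF lh] linear_cmul[OF lh] euler[OF uV])
    have "hess h u v v = hess h u w w + 2 * (a * hess h u w u) + a * (a * hess h u u u)"
      unfolding vw hess_add_square[OF uV] by (simp add: hess_scaleR[OF uV])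
    also have "\<dots> = hess h u w w - a\<^sup>2 * k * (k - 1) * h u"
      unfolding hess_radial[OF uV] Dw euler[OF uV] by (simp add: power2_eq_square algebra_simps)
    also have "\<dots> \<le> C * (a * k * h u)\<^sup>2 - a\<^sup>2 * k * (k - 1) * h u"
      using bound[OF _ nu _ wu] uU closure_subset hue \<epsilon>(2) Dw by (auto simp: subset_iff)
    also have "\<dots> = a\<^sup>2 * k * h u * (C * k * h u - (k - 1))"
      by (simp add: power2_eq_square algebra_simps)
    also have "\<dots> \<le> a\<^sup>2 * k * h u * (- ((k - 1) / 2))"
    proof (rule mult_left_mono)
      have "C * k * h u \<le> (C * k + 1) * h u" using hu0 by (simp add: algebra_simps)
      also have "\<dots> \<le> (C * k + 1) * \<epsilon>" using hue Ck by (intro mult_left_mono) auto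
      also note \<epsilon>2
      finally have "C * k * h u \<le> (k - 1) / 2" .
      moreover have "y - m \<le> - (m / 2)" if "y \<le> m / 2" for y m :: real using that by simp
      ultimately show "C * k * h u - (k - 1) \<le> - ((k - 1) / 2)" by blast
      show "0 \<le> a\<^sup>2 * k * h u" using hu0 k by simp
    qed
    finally have A: "a\<^sup>2 * h u * ((k - 1) / 2) \<le> - hess h u v v / k" using k by (simp add: field_simps)
    have "hess h x v v = r powr (k - 2) * hess h u v v" using hess_scale[OF uU r] xu by simp
    then have "hess_metric x v = r powr (k - 2) * (- hess h u v v / k)" by simp
    also have "\<dots> \<ge> r powr (k - 2) * (a\<^sup>2 * h u * ((k - 1) / 2))" using A by (intro mult_left_mono) auto
    also have "r powr (k - 2) * (a\<^sup>2 * h u * ((k - 1) / 2)) = (k - 1) / 2 * (r powr (k - 2) * r powr (- k)) * a\<^sup>2"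
      unfolding hu by (simp add: mult_ac)
    also have "r powr (k - 2) * r powr (- k) = 1 / r\<^sup>2"
    proof -
      have "r powr (k - 2) * r powr (- k) = r powr (- 2)" by (simp add: powr_add[symmetric])
      also have "\<dots> = 1 / r\<^sup>2" using r by (simp add: powr_minus_divide powr_numeral)
      finally show ?thesis .
    qed
    also have "(k - 1) / 2 * (1 / r\<^sup>2) * a\<^sup>2 = (k - 1) / 2 * ((v \<bullet> x) / (norm x)\<^sup>2)\<^sup>2"
    proof -
      have "(v \<bullet> x) / (norm x)\<^sup>2 = a / r"
        unfolding a_def r_def[symmetric] using r by (simp add: u_def power2_eq_square)
      then show ?thesis by (simp add: power_divide)
    qed
    finally show ?thesis .
  qed
  moreover have "R > 0" unfolding R_def using \<epsilon>(1) by simp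
  ultimately show ?thesis by blast
qed

text \<open>The part of \<open>H\<close> in a ball is compact because \<open>H\<close> is closed, so the positive definite metric
  is comparable with the Euclidean one on it.\<close>

lemma metric_bounds_on_cball:
  "\<exists>c>0. \<exists>M\<ge>0. \<forall>x\<in>H. \<forall>v. norm x \<le> R \<and> D h x v = 0 \<longrightarrow>
     (c * norm v)\<^sup>2 \<le> hess_metric x v \<and> hess_metric x v \<le> (M * norm v)\<^sup>2"
proof -
  define K where "K = (H \<inter> cball 0 R) \<times> sphere (0::'a) 1"
  have compK: "compact K" unfolding K_def
    by (intro compact_Times closed_Int_compact closed_H) auto
  have KV: "fst ` K \<subseteq> V" using H_sub_V by (auto simp: K_def)
  define Z where "Z = K \<inter> (\<lambda>x. D h (fst x) (snd x)) -` {0}"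
  have c2: "continuous_on K (\<lambda>x. D h (fst x) (snd x))"
    by (rule continuous_on_D_pair[OF h _ KV]) (intro continuous_intros)+
  have "closed Z" unfolding Z_def
    using continuous_closed_preimage[OF c2 compact_imp_closed[OF compK]] by simp
  then have compZ: "compact Z" using compact_Int_closed[OF compK, of Z] unfolding Z_def by simp
  have "continuous_on K (\<lambda>x. hess h (fst x) (snd x) (snd x))"
    by (rule continuous_on_hess[OF h _ KV]) (intro continuous_intros)+
  then have c1: "continuous_on Z (\<lambda>x. hess_metric (fst x) (snd x))"
    using k continuous_on_subset[of K _ Z] by (intro continuous_intros) (auto simp: Z_def)
  have pos: "hess_metric (fst x) (snd x) > 0" if "x \<in> Z" for x
  proof -
    have x: "fst x \<in> H" "D h (fst x) (snd x) = 0" "snd x \<noteq> 0"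
      using that by (auto simp: Z_def K_def)
    then have "centroaffine_metric H (fst x) (snd x) (snd x) > 0"
      using hyperbolic tangent_space_H unfolding hyperbolic_def by auto
    then show ?thesis using centroaffine_metric_eq[OF x(1,2,2)] by simp
  qed
  obtain a b where ab: "a > 0" "b > 0" "\<And>x. x \<in> Z \<Longrightarrow> a \<le> hess_metric (fst x) (snd x) \<and> hess_metric (fst x) (snd x) \<le> b"
  proof (cases "Z = {}")
    case True
    then show ?thesis using that[of 1 1] by simp
  next
    case False
    obtain x where x: "x \<in> Z" "\<forall>y\<in>Z. hess_metric (fst x) (snd x) \<le> hess_metric (fst y) (snd y)"
      using continuous_attains_inf[OF compZ False c1] by blast
    obtain y where y: "y \<in> Z" "\<forall>z\<in>Z. hess_metric (fst z) (snd z) \<le> hess_metric (fst y) (snd y)"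
      using continuous_attains_sup[OF compZ False c1] by blast
    show ?thesis
      using that[of "hess_metric (fst x) (snd x)" "hess_metric (fst y) (snd y)"] pos[OF x(1)] pos[OF y(1)] x(2) y(2)
      by blast
  qed
  have "(sqrt a * norm v)\<^sup>2 \<le> hess_metric x v \<and> hess_metric x v \<le> (sqrt b * norm v)\<^sup>2"
    if x: "x \<in> H" "norm x \<le> R" "D h x v = 0" for x v
  proof (cases "v = 0")
    case True
    have "x \<in> V" using x H_sub_V by blast
    then show ?thesis using True linear_0[OF hess_linear_left[OF h]] by simp
  next
    case False
    have xV: "x \<in> V" using x H_sub_V by blast
    define z where "z = (1 / norm v) *\<^sub>R v"
    have v: "v = norm v *\<^sub>R z" using False by (simp add: z_def)
    have "D h x z = 0" unfolding z_def by (simp add: linear_cmul[OF smooth_on_linear_D[OF h xV]] x(3))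
    moreover have "norm z = 1" using False by (simp add: z_def)
    ultimately have "(x, z) \<in> Z" using x by (simp add: Z_def K_def)
    from ab(3)[OF this] have az: "a \<le> hess_metric x z" "hess_metric x z \<le> b" by auto
    have "hess h x v v = (norm v)\<^sup>2 * hess h x z z"
      by (subst (1 2) v) (simp add: hess_scaleR[OF xV] power2_eq_square)
    then have hm: "hess_metric x v = hess_metric x z * (norm v)\<^sup>2" by simp
    have "(sqrt a * norm v)\<^sup>2 = a * (norm v)\<^sup>2" "(sqrt b * norm v)\<^sup>2 = b * (norm v)\<^sup>2"
      using ab(1,2) by (simp_all add: power_mult_distrib)
    then show ?thesis
      unfolding hm using mult_right_mono[OF az(1), of "(norm v)\<^sup>2"] mult_right_mono[OF az(2), of "(norm v)\<^sup>2"]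
      by simp
  qed
  then show ?thesis using ab(1,2) by (intro exI[of _ "sqrt a"] conjI exI[of _ "sqrt b"]) auto
qed

subsection \<open>Curves of bounded centroaffine length\<close>

lemma curve_metric:
  assumes \<gamma>: "path_image \<gamma> \<subseteq> H" and t: "t \<in> {0<..<1}" and d: "\<gamma> differentiable (at t)"
  defines "v \<equiv> vector_derivative \<gamma> (at t)"
  shows "\<gamma> t \<in> H" "D h (\<gamma> t) v = 0" "centroaffine_metric H (\<gamma> t) v v = hess_metric (\<gamma> t) v"
proof -
  have on: "\<gamma> s \<in> H" if "s \<in> {0<..<1}" for s using \<gamma> that by (auto simp: path_image_def)
  show g: "\<gamma> t \<in> H" using on t .
  then have gV: "\<gamma> t \<in> V" using H_sub_V by blast
  have "(\<gamma> has_derivative (\<lambda>s. s *\<^sub>R v)) (at t)"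
    using d unfolding v_def vector_derivative_works has_vector_derivative_def .
  from has_derivative_compose[OF this smooth_on_has_derivative[OF h gV]]
  have 1: "((\<lambda>s. h (\<gamma> s)) has_derivative (\<lambda>s. D h (\<gamma> t) (s *\<^sub>R v))) (at t)" .
  have "((\<lambda>s. h (\<gamma> s)) has_derivative (\<lambda>s. 0)) (at t)"
    by (rule has_derivative_transform_within_open[OF has_derivative_const[of 1] open_greaterThanLessThan t])
       (simp add: h_H[OF on])
  from fun_cong[OF has_derivative_unique[OF 1 this], of 1] show Dv: "D h (\<gamma> t) v = 0" by simp
  show "centroaffine_metric H (\<gamma> t) v v = hess_metric (\<gamma> t) v" using centroaffine_metric_eq[OF g Dv Dv] .
qed

text \<open>After the last parameter \<open>t0\<close> before \<open>t1\<close> at which it is in the ball of radius \<open>R1\<close>, the curve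
  runs where the radial estimate holds, so its length bounds the growth of \<open>log |x|\<close>.\<close>

lemma curves_bounded:
  "\<exists>R'. \<forall>\<gamma>. valid_path \<gamma> \<and> path_image \<gamma> \<subseteq> H \<and> norm (pathstart \<gamma>) \<le> R \<and>
      curve_length (centroaffine_metric H) \<gamma> < 1 \<longrightarrow> path_image \<gamma> \<subseteq> cball 0 R'"
proof -
  obtain R0 where R0: "R0 > 0" and radial: "\<And>x v. x \<in> H \<Longrightarrow> R0 < norm x \<Longrightarrow> D h x v = 0 \<Longrightarrow>
     (k - 1) / 2 * ((v \<bullet> x) / (norm x)\<^sup>2)\<^sup>2 \<le> hess_metric x v"
    using metric_ge_radial by blast
  define c where "c = sqrt ((k - 1) / 2)"
  have c: "c > 0" "c\<^sup>2 = (k - 1) / 2" unfolding c_def using k by auto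
  define R1 where "R1 = max R R0"
  have R1: "R1 > 0" "R0 \<le> R1" "R \<le> R1" unfolding R1_def using R0 by auto
  define R' where "R' = R1 * exp (1 / c)"
  have R1R': "R1 \<le> R'" unfolding R'_def using R1(1) c(1) by simp
  have "norm (\<gamma> t1) \<le> R'"
    if \<gamma>: "valid_path \<gamma>" "path_image \<gamma> \<subseteq> H" "norm (pathstart \<gamma>) \<le> R"
      and len: "curve_length (centroaffine_metric H) \<gamma> < 1" and t1: "t1 \<in> {0..1}" for \<gamma> t1
  proof (rule ccontr)
    assume "\<not> norm (\<gamma> t1) \<le> R'"
    then have big: "R' < norm (\<gamma> t1)" by simp
    have on: "\<gamma> t \<in> H" if "t \<in> {0..1}" for t using \<gamma>(2) that by (auto simp: path_image_def)
    have "continuous_on {0..1} \<gamma>" using valid_path_imp_path[OF \<gamma>(1)] by (simp add: path_def)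
    then have "continuous_on {0..t1} (\<lambda>t. norm (\<gamma> t))"
      using t1 by (intro continuous_on_norm) (auto elim: continuous_on_subset)
    then have "closed ({0..t1} \<inter> (\<lambda>t. norm (\<gamma> t)) -` {..R1})"
      by (intro continuous_closed_preimage) auto
    then have "compact ({0..t1} \<inter> (\<lambda>t. norm (\<gamma> t)) -` {..R1})"
      by (metis closed_Int_compact compact_Icc inf.left_idem inf_commute)
    moreover have "0 \<in> {0..t1} \<inter> (\<lambda>t. norm (\<gamma> t)) -` {..R1}"
      using \<gamma>(3) R1 t1 by (simp add: pathstart_def)
    then have "{0..t1} \<inter> (\<lambda>t. norm (\<gamma> t)) -` {..R1} \<noteq> {}" by blast
    ultimately obtain t0 where t0': "t0 \<in> {0..t1} \<inter> (\<lambda>t. norm (\<gamma> t)) -` {..R1}"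
      and last': "\<forall>t\<in>{0..t1} \<inter> (\<lambda>t. norm (\<gamma> t)) -` {..R1}. t \<le> t0"
      using compact_attains_sup by metis
    have t0: "t0 \<in> {0..t1}" "norm (\<gamma> t0) \<le> R1" using t0' by auto
    have last: "t \<le> t0" if "t \<in> {0..t1}" "norm (\<gamma> t) \<le> R1" for t
      using last' that by (simp add: Ball_def)
    let ?f = "\<lambda>x::'a. ln (norm x)" and ?f' = "\<lambda>x v::'a. (v \<bullet> x) / (norm x)\<^sup>2"
    have "ennreal (c * norm (?f (\<gamma> t1) - ?f (\<gamma> t0))) \<le> curve_length (centroaffine_metric H) \<gamma>"
    proof (rule curve_length_ge[OF \<gamma>(1), where W = "- {0}" and f' = ?f'])
      show "0 \<le> t0" "t0 \<le> t1" "t1 \<le> 1" "c \<ge> 0" using t0 t1 c by auto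
      show "\<gamma> ` {t0..t1} \<subseteq> - {0}" 
      proof
        fix x assume "x \<in> \<gamma> ` {t0..t1}"
        then obtain t where "t \<in> {t0..t1}" "x = \<gamma> t" by blast
        then have "x \<in> H" using on[of t] t0(1) t1 by simp
        then show "x \<in> - {0}" using zero_notin by auto
      qed
      show "(?f has_derivative ?f' x) (at x)" if "x \<in> - {0}" for x
      proof -
        have "(norm has_derivative (\<lambda>v. v \<bullet> sgn x)) (at x)"
          using that has_derivative_norm[of x] by (simp add: inner_commute)
        then have "(?f has_derivative (\<lambda>v. (v \<bullet> sgn x) * inverse (norm x))) (at x)"
          using that by (auto intro!: derivative_eq_intros simp: divide_inverse)
        moreover have "(v \<bullet> sgn x) * inverse (norm x) = ?f' x v" for v
          by (simp add: sgn_div_norm power2_eq_square field_simps)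
        ultimately show ?thesis by simp
      qed
      show "continuous_on ((- {0}) \<times> UNIV) (\<lambda>(x, v). ?f' x v)"
        by (auto intro!: continuous_intros simp: case_prod_beta)
      fix t assume t: "t \<in> {t0<..<t1}" and d: "\<gamma> differentiable (at t)"
      let ?v = "vector_derivative \<gamma> (at t)"
      have "t \<in> {0<..<1}" using t t0 t1 by auto
      note cm = curve_metric[OF \<gamma>(2) this d]
      have "R1 < norm (\<gamma> t)" using last[of t] t t0 by force
      then have "(k - 1) / 2 * (?f' (\<gamma> t) ?v)\<^sup>2 \<le> hess_metric (\<gamma> t) ?v"
        using R1(2) by (intro radial[OF cm(1) _ cm(2)]) simp
      moreover have "(c * norm y)\<^sup>2 = (k - 1) / 2 * y\<^sup>2" for y :: real
        unfolding power_mult_distrib c(2) by simp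
      ultimately have "(c * norm (?f' (\<gamma> t) ?v))\<^sup>2 \<le> hess_metric (\<gamma> t) ?v" by (simp only:)
      then show "c * norm (?f' (\<gamma> t) ?v) \<le> sqrt (centroaffine_metric H (\<gamma> t) ?v ?v)"
        unfolding cm(3) by (rule real_le_rsqrt)
    qed
    from le_less_trans[OF this len]
    have "ennreal (c * norm (?f (\<gamma> t1) - ?f (\<gamma> t0))) < ennreal 1" unfolding ennreal_1 .
    then have lt: "c * norm (?f (\<gamma> t1) - ?f (\<gamma> t0)) < 1" by (subst (asm) ennreal_less_iff) (use c in auto)
    have "\<gamma> t0 \<noteq> 0" using on[of t0] t0 t1 zero_notin by auto
    then have "?f (\<gamma> t0) \<le> ln R1" using t0(2) by (intro ln_mono) auto
    moreover have "ln R' < ?f (\<gamma> t1)" using big R1R' R1(1) by (subst ln_less_cancel_iff) auto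
    moreover have "ln R' = ln R1 + 1 / c" unfolding R'_def using R1(1) by (simp add: ln_mult)
    ultimately have "1 / c < norm (?f (\<gamma> t1) - ?f (\<gamma> t0))" by simp
    then show False using lt c(1) by (simp add: field_simps)
  qed
  then show ?thesis by (intro exI[of _ R']) (auto simp: path_image_def)
qed

text \<open>Short curves stay in a compact part of \<open>H\<close>, where their length controls the Euclidean one.\<close>

lemma curves_euclidean_length:
  "\<exists>c>0. \<forall>\<gamma>. valid_path \<gamma> \<and> path_image \<gamma> \<subseteq> H \<and> norm (pathstart \<gamma>) \<le> R \<and>
      curve_length (centroaffine_metric H) \<gamma> < 1 \<longrightarrow>
      ennreal (c * norm (pathfinish \<gamma> - pathstart \<gamma>)) \<le> curve_length (centroaffine_metric H) \<gamma>"
proof -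
  from curves_bounded[of R] obtain R' where "\<forall>\<gamma>. valid_path \<gamma> \<and> path_image \<gamma> \<subseteq> H \<and>
      norm (pathstart \<gamma>) \<le> R \<and> curve_length (centroaffine_metric H) \<gamma> < 1 \<longrightarrow>
      path_image \<gamma> \<subseteq> cball 0 R'" ..
  then have R': "path_image \<gamma> \<subseteq> cball 0 R'" if "valid_path \<gamma>" "path_image \<gamma> \<subseteq> H"
      "norm (pathstart \<gamma>) \<le> R" "curve_length (centroaffine_metric H) \<gamma> < 1" for \<gamma>
    using that by simp
  obtain c where c: "c > 0" "\<And>x v. x \<in> H \<Longrightarrow> norm x \<le> R' \<Longrightarrow> D h x v = 0 \<Longrightarrow> (c * norm v)\<^sup>2 \<le> hess_metric x v"
    using metric_bounds_on_cball[of R'] by blast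
  have "ennreal (c * norm (pathfinish \<gamma> - pathstart \<gamma>)) \<le> curve_length (centroaffine_metric H) \<gamma>"
    if \<gamma>: "valid_path \<gamma>" "path_image \<gamma> \<subseteq> H" "norm (pathstart \<gamma>) \<le> R"
      and len: "curve_length (centroaffine_metric H) \<gamma> < 1" for \<gamma>
    unfolding pathfinish_def pathstart_def
  proof (rule curve_length_ge[OF \<gamma>(1), where W = UNIV and f' = "\<lambda>x v. v"])
    fix t :: real assume t: "t \<in> {0<..<1}" and d: "\<gamma> differentiable (at t)"
    let ?v = "vector_derivative \<gamma> (at t)"
    note cm = curve_metric[OF \<gamma>(2) t d]
    have "norm (\<gamma> t) \<le> R'" 
    proof -
      have "\<gamma> t \<in> path_image \<gamma>" using t by (simp add: path_image_def)
      then have "\<gamma> t \<in> cball 0 R'" using R'[OF \<gamma> len] by blast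
      then show ?thesis by simp
    qed
    from c(2)[OF cm(1) this cm(2)] show "c * norm ?v \<le> sqrt (centroaffine_metric H (\<gamma> t) ?v ?v)"
      unfolding cm(3) by (rule real_le_rsqrt)
  qed (use c in \<open>auto simp: case_prod_beta intro: continuous_intros\<close>)
  then show ?thesis using c(1) by blast
qed

text \<open>Near \<open>l\<close> the level set is all of \<open>H\<close>, and the straightened segments from \<open>\<sigma> n\<close> to \<open>l\<close> have
  length at most a constant times their length in the chart.\<close>

lemma dist_to_limit:
  assumes l: "l \<in> H" and s: "\<And>n. \<sigma> n \<in> H" "\<sigma> \<longlonglongrightarrow> l"
  shows "(\<lambda>n. riemannian_dist H (centroaffine_metric H) (\<sigma> n) l) \<longlonglongrightarrow> 0"
proof -
  have W: "open (ball l 1)" "l \<in> ball l 1" by auto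
  obtain N r G F \<nu> C where NW: "N \<subseteq> ball l 1" and chart: "level_chart h l N r G F \<nu> C"
    and sub: "{q \<in> N. h q = 1} \<subseteq> H"
    by (rule chart_at_H[OF l W])
  interpret level_chart h l N r G F \<nu> C by (rule chart)
  obtain M where M: "M \<ge> 0"
    "\<And>x v. x \<in> H \<Longrightarrow> norm x \<le> norm l + 1 \<Longrightarrow> D h x v = 0 \<Longrightarrow> hess_metric x v \<le> (M * norm v)\<^sup>2"
    using metric_bounds_on_cball[of "norm l + 1"] by blast
  have le: "riemannian_dist H (centroaffine_metric H) x l \<le> ennreal (M * (C * norm (G l - G x)))"
    if x: "x \<in> H" "x \<in> N" for x
  proof -
    have eq: "D h l (G x) = 1" "D h l (G l) = 1" using h_eq x p_in h_H l by auto
    then have "D h l (G x) = D h l (G l)" by simp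
    note path = level_path[OF G_in[OF x(2)] G_in[OF p_in] this]
    let ?\<eta> = "\<lambda>t. F (G x + t *\<^sub>R (G l - G x))"
    have on: "?\<eta> t \<in> H" "norm (?\<eta> t) \<le> norm l + 1" if "t \<in> {0..1}" for t
    proof -
      have "?\<eta> t \<in> N" "h (?\<eta> t) = 1" using path(4)[OF that] eq by auto
      then show "?\<eta> t \<in> H" using sub by blast
      have "dist l (?\<eta> t) < 1" using \<open>?\<eta> t \<in> N\<close> NW by auto
      then show "norm (?\<eta> t) \<le> norm l + 1" using norm_triangle_ineq2[of "?\<eta> t" l] by (simp add: dist_norm norm_minus_commute)
    qed
    have "riemannian_dist H (centroaffine_metric H) x l \<le> curve_length (centroaffine_metric H) ?\<eta>"
      by (rule riemannian_dist_le)
         (use path(1-3) on FG[OF x(2)] FG[OF p_in] in \<open>auto simp: path_image_def\<close>)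
    also have "\<dots> \<le> ennreal (M * (C * norm (G l - G x)))"
    proof (rule curve_length_le)
      show "0 \<le> M * (C * norm (G l - G x))" using M(1) C_pos by simp
      fix t :: real assume t: "t \<in> {0..1}"
      let ?v = "vector_derivative ?\<eta> (at t)"
      have v: "D h (?\<eta> t) ?v = 0" "norm ?v \<le> C * norm (G l - G x)" using path(5)[OF t] by auto
      have "centroaffine_metric H (?\<eta> t) ?v ?v \<le> (M * norm ?v)\<^sup>2"
        using M(2)[OF on[OF t] v(1)] centroaffine_metric_eq[OF on(1)[OF t] v(1) v(1)] by simp
      also have "\<dots> \<le> (M * (C * norm (G l - G x)))\<^sup>2" using v(2) M(1) by (intro power_mono mult_left_mono) auto
      finally show "centroaffine_metric H (?\<eta> t) ?v ?v \<le> (M * (C * norm (G l - G x)))\<^sup>2" .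
    qed
    finally show ?thesis .
  qed
  have ev: "\<forall>\<^sub>F n in sequentially. \<sigma> n \<in> N" using topological_tendstoD[OF s(2) open_N p_in] .
  have "(\<lambda>n. G (\<sigma> n)) \<longlonglongrightarrow> G l"
    by (rule continuous_on_tendsto_compose[OF continuous_G s(2) p_in ev])
  then have "(\<lambda>n. M * (C * norm (G l - G (\<sigma> n)))) \<longlonglongrightarrow> M * (C * norm (G l - G l))"
    by (intro tendsto_intros)
  then have "(\<lambda>n. ennreal (M * (C * norm (G l - G (\<sigma> n))))) \<longlonglongrightarrow> ennreal 0"
    by (intro tendsto_ennrealI) simp
  then have lim: "(\<lambda>n. ennreal (M * (C * norm (G l - G (\<sigma> n))))) \<longlonglongrightarrow> 0" by simp
  show ?thesis
  proof (rule tendsto_sandwich[OF always_eventually[OF allI[OF zero_le]] _ tendsto_const lim])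
    show "\<forall>\<^sub>F n in sequentially. riemannian_dist H (centroaffine_metric H) (\<sigma> n) l
        \<le> ennreal (M * (C * norm (G l - G (\<sigma> n))))"
      using ev by eventually_elim (use le s(1) in blast)
  qed
qed

text \<open>The Euclidean bound for short curves depends on a bound \<open>R\<close> for their initial points. Used with
  a single term \<open>\<sigma> N0\<close> of the Cauchy sequence it shows that the sequence is bounded; used again
  with that bound it shows that the sequence is Cauchy in the ambient space, and \<open>H\<close> is closed.\<close>

theorem complete_centroaffine: "riemannian_complete H (centroaffine_metric H)"
  unfolding riemannian_complete_def
proof (intro allI impI, elim conjE)
  fix \<sigma> :: "nat \<Rightarrow> 'a"
  let ?d = "riemannian_dist H (centroaffine_metric H)"
  assume ran: "range \<sigma> \<subseteq> H" and cau: "\<forall>e>0. \<exists>N. \<forall>i\<ge>N. \<forall>j\<ge>N. ?d (\<sigma> i) (\<sigma> j) < e"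
  have \<sigma>H: "\<sigma> n \<in> H" for n using ran by blast
  have Cauchy_step: "\<exists>c>0. \<forall>i j e. norm (\<sigma> i) \<le> R \<and> ?d (\<sigma> i) (\<sigma> j) < ennreal e \<and> 0 < e \<and> e \<le> 1 \<longrightarrow>
      c * norm (\<sigma> j - \<sigma> i) < e" for R
  proof -
    obtain c where c: "c > 0" and le: "\<And>\<gamma>. valid_path \<gamma> \<Longrightarrow> path_image \<gamma> \<subseteq> H \<Longrightarrow> norm (pathstart \<gamma>) \<le> R \<Longrightarrow>
      curve_length (centroaffine_metric H) \<gamma> < 1 \<Longrightarrow>
      ennreal (c * norm (pathfinish \<gamma> - pathstart \<gamma>)) \<le> curve_length (centroaffine_metric H) \<gamma>"
      using curves_euclidean_length[of R] by blast
    have "c * norm (\<sigma> j - \<sigma> i) < e"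
      if i: "norm (\<sigma> i) \<le> R" and d: "?d (\<sigma> i) (\<sigma> j) < ennreal e" and e: "0 < e" "e \<le> 1" for i j e
    proof -
      obtain \<gamma> where \<gamma>: "valid_path \<gamma>" "path_image \<gamma> \<subseteq> H" "pathstart \<gamma> = \<sigma> i" "pathfinish \<gamma> = \<sigma> j"
        and len: "curve_length (centroaffine_metric H) \<gamma> < ennreal e"
        using riemannian_dist_lessE[OF d] .
      have "ennreal e \<le> 1" using e by simp
      then have "curve_length (centroaffine_metric H) \<gamma> < 1" using len by (rule less_le_trans[rotated])
      from le[OF \<gamma>(1,2) _ this] i \<gamma>(3,4)
      have "ennreal (c * norm (\<sigma> j - \<sigma> i)) \<le> curve_length (centroaffine_metric H) \<gamma>" by simp
      then have "ennreal (c * norm (\<sigma> j - \<sigma> i)) < ennreal e" using len by (rule le_less_trans)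
      then show ?thesis by (subst (asm) ennreal_less_iff) (use c in auto)
    qed
    then show ?thesis using c by blast
  qed
  obtain N0 where N0: "\<And>i j. i \<ge> N0 \<Longrightarrow> j \<ge> N0 \<Longrightarrow> ?d (\<sigma> i) (\<sigma> j) < 1"
    using cau zero_less_one by blast
  obtain c0 where c0: "c0 > 0" "\<And>j. ?d (\<sigma> N0) (\<sigma> j) < 1 \<Longrightarrow> c0 * norm (\<sigma> j - \<sigma> N0) < 1"
    using Cauchy_step[of "norm (\<sigma> N0)"] by (metis ennreal_1 order_refl zero_less_one)
  define R where "R = norm (\<sigma> N0) + 1 / c0"
  have bdd: "norm (\<sigma> j) \<le> R" if "j \<ge> N0" for j
  proof -
    have "c0 * norm (\<sigma> j - \<sigma> N0) < 1" using c0(2) N0 that by blast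
    then have "norm (\<sigma> j - \<sigma> N0) < 1 / c0" using c0(1) by (simp add: field_simps)
    then show ?thesis unfolding R_def using norm_triangle_ineq2[of "\<sigma> j" "\<sigma> N0"] by linarith
  qed
  obtain c where c: "c > 0"
    and less: "\<And>i j e. norm (\<sigma> i) \<le> R \<Longrightarrow> ?d (\<sigma> i) (\<sigma> j) < ennreal e \<Longrightarrow> 0 < e \<Longrightarrow> e \<le> 1 \<Longrightarrow>
      c * norm (\<sigma> j - \<sigma> i) < e"
    using Cauchy_step[of R] by blast
  have "Cauchy \<sigma>"
  proof (rule metric_CauchyI)
    fix e :: real assume e: "0 < e"
    define e' where "e' = min 1 (c * e)"
    have e': "0 < e'" "e' \<le> 1" "e' \<le> c * e" unfolding e'_def using c e by auto
    obtain N where N: "\<And>i j. i \<ge> N \<Longrightarrow> j \<ge> N \<Longrightarrow> ?d (\<sigma> i) (\<sigma> j) < ennreal e'"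
      using cau e'(1) by (metis ennreal_less_zero_iff)
    have "dist (\<sigma> i) (\<sigma> j) < e" if "i \<ge> max N N0" "j \<ge> max N N0" for i j
    proof -
      have "c * norm (\<sigma> j - \<sigma> i) < e'" using less[OF bdd N e'(1,2)] that by simp
      then have "c * norm (\<sigma> j - \<sigma> i) < c * e" using e'(3) by linarith
      then show ?thesis using c by (simp add: dist_norm norm_minus_commute)
    qed
    then show "\<exists>M. \<forall>m\<ge>M. \<forall>n\<ge>M. dist (\<sigma> m) (\<sigma> n) < e" by blast
  qed
  then obtain l where l: "\<sigma> \<longlonglongrightarrow> l" using Cauchy_convergent_iff convergent_def by blast
  have "l \<in> H" using closed_sequentially[OF closed_H \<sigma>H l] .
  then show "\<exists>l\<in>H. (\<lambda>i. ?d (\<sigma> i) l) \<longlonglongrightarrow> 0" using dist_to_limit[OF _ \<sigma>H l] by blast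
qed

end

theorem theorem1p18:
  fixes n :: nat and H :: "(real ^ 'm) set"
  assumes "n \<ge> 1" and "CARD('m) = n + 1"
    and "centroaffine_hypersurface H"
    and "connected H"
    and "hyperbolic H"
    and "euclidean_complete H"
    and "regular_boundary_behaviour H"
  shows "riemannian_complete H (centroaffine_metric H)"
proof -
  from assms(7) obtain k h V where *: "k > 1" "closure (cone_over H) - {0} \<subseteq> V" "smooth_on h V"
      "homogeneous_on V k h" "H = {p \<in> cone_over H. h p = 1}"
    and bdry: "\<forall>p\<in>frontier (cone_over H) - {0}. D h p \<noteq> (\<lambda>v. 0) \<and>
        (let T = tangent_space (frontier (cone_over H) - {0}) p in
           (\<forall>v\<in>T. - hess h p v v \<ge> 0) \<and> dim {v \<in> T. \<forall>w\<in>T. - hess h p v w = 0} = 1)"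
    unfolding regular_boundary_behaviour_def by (elim exE conjE) (rule that; assumption)
  (* \<open>0\<close> is a tangent vector at every point, the velocity of a constant curve *)
  have "0 \<notin> H"
  proof
    assume 0: "0 \<in> H"
    have "0 \<in> tangent_space H 0"
      unfolding tangent_space_def mem_Collect_eq
      by (intro exI[of _ "\<lambda>t. 0"] exI[of _ 1] conjI smooth_on_const) (use 0 in auto)
    then show False using assms(3) 0 unfolding centroaffine_hypersurface_def by blast
  qed
  interpret regular_cone_function H k h V
    by unfold_locales
       (use assms(3,5,6) * \<open>0 \<notin> H\<close> bdry in \<open>auto simp: centroaffine_hypersurface_def Let_def\<close>)
  show ?thesis by (rule complete_centroaffine)
qed

end
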